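(* For every $\epsilon>0$, the second order equation $$\ddot x + \epsilon\,\dot x\,(x^2 + x\dot x + \dot x^2 - 1) + x = 0,$$ regarded as the planar system $\dot x = y$, $\dot y = -x - \epsilon\, y\,(x^2+xy+y^2-1)$, has exactly one limit cycle, and every non-constant solution is attracted to this limit cycle.
   Context: A limit cycle of a planar autonomous system means the orbit (closed curve) of a non-constant periodic solution; periodic solutions with the same orbit determine the same limit cycle. A solution $\gamma(t)$ is attracted to a limit cycle $\Gamma$ if $\gamma(t)$ is defined for all sufficiently large $t$ and $\operatorname{dist}(\gamma(t),\Gamma)\to 0$ as $t\to+\infty$. *)

theory Defs
  imports "HOL-Analysis.Analysis"
begin

definition is_solution ::
  "('a \<Rightarrow> 'a) \<Rightarrow> real set \<Rightarrow> (real \<Rightarrow> 'a::real_normed_vector) \<Rightarrow> bool" where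
  "is_solution f I \<gamma> \<longleftrightarrow>
     open I \<and> is_interval I \<and> I \<noteq> {} \<and>
     (\<forall>t\<in>I. (\<gamma> has_vector_derivative f (\<gamma> t)) (at t))"

text \<open>As usual, a solution without further qualification is one on its maximal interval of
  existence; the values of \<open>\<gamma>\<close> outside \<open>I\<close> are irrelevant.\<close>

definition maximal_solution ::
  "('a \<Rightarrow> 'a) \<Rightarrow> real set \<Rightarrow> (real \<Rightarrow> 'a::real_normed_vector) \<Rightarrow> bool" where
  "maximal_solution f I \<gamma> \<longleftrightarrow>
     is_solution f I \<gamma> \<and>
     (\<forall>J \<delta>. is_solution f J \<delta> \<and> I \<subseteq> J \<and> (\<forall>t\<in>I. \<delta> t = \<gamma> t) \<longrightarrow> J = I)"

definition limit_cycle :: "('a \<Rightarrow> 'a) \<Rightarrow> 'a::real_normed_vector set \<Rightarrow> bool" where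
  "limit_cycle f \<Gamma> \<longleftrightarrow>
     (\<exists>\<gamma> T. is_solution f UNIV \<gamma> \<and> T > 0 \<and> (\<forall>t. \<gamma> (t + T) = \<gamma> t) \<and>
            \<not> \<gamma> constant_on UNIV \<and> \<Gamma> = range \<gamma>)"

definition attracted_to :: "real set \<Rightarrow> (real \<Rightarrow> 'a::metric_space) \<Rightarrow> 'a set \<Rightarrow> bool" where
  "attracted_to I \<gamma> \<Gamma> \<longleftrightarrow>
     (\<exists>t\<^sub>0. {t\<^sub>0..} \<subseteq> I) \<and> ((\<lambda>t. infdist (\<gamma> t) \<Gamma>) \<longlongrightarrow> 0) at_top"

text \<open>The planar system \<open>x' = y\<close>, \<open>y' = - x - \<epsilon> y (x\<^sup>2 + x y + y\<^sup>2 - 1)\<close>.\<close>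

definition planar_field :: "real \<Rightarrow> real \<times> real \<Rightarrow> real \<times> real" where
  "planar_field \<epsilon> = (\<lambda>(x, y). (y, - x - \<epsilon> * y * (x\<^sup>2 + x * y + y\<^sup>2 - 1)))"

end

theory Submission
  imports Defs
begin

text \<open>
  Write \<open>x = r cos p\<close>, \<open>y = - r sin p\<close>, \<open>z = 1 / r\<^sup>2\<close>, \<open>\<sigma> = sin p cos p\<close> (\<open>sg p\<close> below) and
  \<open>q = 1 - \<sigma>\<close>. The system becomes \<open>z' = - 2 \<epsilon> sin\<^sup>2 p (z - q)\<close>, \<open>p' = ang p z / z\<close> with
  \<open>ang p z = z + \<epsilon> \<sigma> (z - q)\<close>. For the scalar equation of \<open>z\<close> as a function of \<open>p\<close> the region
  \<open>1/2 \<le> z \<le> 3/2\<close>, \<open>ang p z \<ge> \<delta>\<close> is forward invariant when \<open>\<delta>\<close> is small, so its Poincare map over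
  one period \<open>pi\<close> has a fixed point, which gives a periodic profile \<open>Z\<close> and hence a limit cycle
  met once by every ray. For an arbitrary nonzero solution the ratio \<open>W = z / Z(p)\<close> satisfies
  \<open>W' = k (1 - W)\<close> with \<open>k = 2 \<epsilon> sin\<^sup>2 p q / ang p (Z p) \<ge> 0\<close>, even while \<open>p\<close> is not monotone.
  So the solution stays bounded, exists for all later times, and \<open>W\<close> tends to \<open>1\<close>. A periodic
  solution therefore has \<open>W = 1\<close>, and \<open>p' \<ge> 2 \<delta> / 3\<close> makes it run through the whole cycle.
\<close>

section \<open>Ordinary differential equations\<close>

lemma antiderivative_on_open_interval:
  fixes h :: "real \<Rightarrow> 'a::banach"
  assumes "open I" "is_interval I" "t0 \<in> I" "continuous_on I h"
  obtains H where "H t0 = 0" "\<And>t. t \<in> I \<Longrightarrow> (H has_vector_derivative h t) (at t)"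
proof -
  \<comment> \<open>An interval with reversed endpoints is empty and contributes zero, so the
    difference is the oriented integral from \<open>t0\<close> to \<open>t\<close> on either side of
    \<open>t0\<close>.\<close>
  define H where "H t = integral {t0..t} h - integral {t..t0} h" for t
  have "(H has_vector_derivative h t) (at t)" if t: "t \<in> I" for t
  proof -
    obtain e where e: "e > 0" "cball t e \<subseteq> I" "cball t0 e \<subseteq> I"
    proof -
      obtain e1 where "e1 > 0" "cball t e1 \<subseteq> I" using \<open>open I\<close> t open_contains_cball by blast
      moreover obtain e2 where "e2 > 0" "cball t0 e2 \<subseteq> I"
        using assms(1,3) open_contains_cball by blast
      ultimately show thesis by (intro that[of "min e1 e2"]) auto
    qed
    define a where "a = min t t0 - e"
    define b where "b = max t t0 + e"
    have "a \<in> I" "b \<in> I"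
      using e by (auto simp: a_def b_def min_def max_def cball_eq_atLeastAtMost subset_iff)
    hence ab: "{a..b} \<subseteq> I"
      using \<open>is_interval I\<close> by (meson atLeastAtMost_iff is_interval_1 subsetI)
    have cont: "continuous_on {a..b} h" using continuous_on_subset[OF assms(4) ab] .
    have int: "h integrable_on {c..d}" if "a \<le> c" "d \<le> b" for c d
      using that by (intro integrable_continuous_real continuous_on_subset[OF cont]) auto
    have atb: "a < t" "t < b" "a < t0" "t0 < b" using e(1) by (auto simp: a_def b_def)
    have eq: "integral {a..u} h - integral {a..t0} h = H u" if "u \<in> {a<..<b}" for u
    proof (cases "u \<le> t0")
      case True
      have "integral {a..u} h + integral {u..t0} h = integral {a..t0} h"
        using that True atb by (intro Henstock_Kurzweil_Integration.integral_combine int) auto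
      thus ?thesis using True by (cases "u = t0") (auto simp: H_def algebra_simps)
    next
      case False
      have "integral {a..t0} h + integral {t0..u} h = integral {a..u} h"
        using that False atb by (intro Henstock_Kurzweil_Integration.integral_combine int) auto
      thus ?thesis using False by (auto simp: H_def algebra_simps)
    qed
    have "((\<lambda>u. integral {a..u} h) has_vector_derivative h t) (at t within {a..b})"
      using atb by (intro integral_has_vector_derivative cont) auto
    hence "((\<lambda>u. integral {a..u} h) has_vector_derivative h t) (at t)"
      using atb at_within_Icc_at by metis
    hence "((\<lambda>u. integral {a..u} h - integral {a..t0} h) has_vector_derivative h t) (at t)"
      by (auto intro!: derivative_eq_intros)
    thus ?thesis
      by (rule has_vector_derivative_transform_within_open[where S = "{a<..<b}"])
         (use atb eq in auto)
  qed
  moreover have "H t0 = 0" by (simp add: H_def)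
  ultimately show thesis using that by blast
qed

text \<open>Integrating the weight from 0 gains the factor \<open>1 / K\<close>; this gain is what
  makes the integral operator of \<open>picard_global\<close> contract. Negative times reduce to
  positive ones by time reversal.\<close>

lemma exp_derivative_imp_exp_bound:
  fixes G :: "real \<Rightarrow> 'a::real_normed_vector"
  assumes der: "\<And>t. (G has_vector_derivative g t) (at t)" and "G 0 = 0"
    and "K > 0" and bnd: "\<And>t. norm (g t) \<le> B * exp (K * \<bar>t\<bar>)"
  shows "norm (G t) \<le> B / K * exp (K * \<bar>t\<bar>)"
proof -
  have B: "B \<ge> 0" using bnd[of 0] by (simp add: order_trans[OF norm_ge_zero])
  have *: "norm (F t) \<le> B / K * exp (K * t)"
    if "0 \<le> t" "\<And>t. (F has_vector_derivative f t) (at t)" "F 0 = 0"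
      "\<And>t. norm (f t) \<le> B * exp (K * \<bar>t\<bar>)" for F f :: "real \<Rightarrow> 'a" and t
  proof (cases "t = 0")
    case True thus ?thesis using that \<open>K > 0\<close> B by simp
  next
    case False
    have "norm (F t - F 0) \<le> B / K * exp (K * t) - B / K * exp (K * 0)"
    proof (rule differentiable_bound_general[where f' = f and \<phi>' = "\<lambda>t. B * exp (K * t)"])
      show "continuous_on {0..t} F"
        using that(2) by (meson continuous_at_imp_continuous_on has_vector_derivative_continuous)
      show "((\<lambda>t. B / K * exp (K * t)) has_vector_derivative B * exp (K * x)) (at x)" for x
        unfolding has_real_derivative_iff_has_vector_derivative[symmetric]
        using \<open>K > 0\<close> by (auto intro!: derivative_eq_intros)
      show "norm (f x) \<le> B * exp (K * x)" if "0 < x" for x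
        using \<open>\<And>t. norm (f t) \<le> B * exp (K * \<bar>t\<bar>)\<close>[of x] that by simp
    qed (use that False \<open>K > 0\<close> in \<open>auto intro!: continuous_intros\<close>)
    also have "\<dots> \<le> B / K * exp (K * t)" using B \<open>K > 0\<close> by simp
    finally show ?thesis using that by simp
  qed
  show ?thesis
  proof (cases "t \<ge> 0")
    case True
    thus ?thesis using *[of t G g] assms by simp
  next
    case False
    have "((\<lambda>t. G (- t)) has_vector_derivative (-1) *\<^sub>R g (- t)) (at t)" for t
      unfolding o_def[of G uminus, symmetric]
      by (rule vector_diff_chain_at) (auto intro!: derivative_eq_intros der)
    moreover have "norm ((-1) *\<^sub>R g (- t)) \<le> B * exp (K * \<bar>t\<bar>)" for t
      using bnd[of "- t"] by simp
    ultimately show ?thesis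
      using *[of "- t" "\<lambda>t. G (- t)" "\<lambda>t. (-1) *\<^sub>R g (- t)"] False assms(2) by simp
  qed
qed

text \<open>The integral operator is a contraction for the norm weighted by \<open>exp (- 2 L \<bar>t\<bar>)\<close>, so one
  application of Banach's theorem gives a solution on the whole line. \<open>W\<close> below is the weighted
  solution.\<close>

theorem picard_global:
  fixes f :: "real \<Rightarrow> 'a::banach \<Rightarrow> 'a"
  assumes cont: "continuous_on UNIV (\<lambda>p. f (fst p) (snd p))"
    and lip: "\<And>t x y. norm (f t x - f t y) \<le> L * norm (x - y)"
    and bnd: "\<And>t x. norm (f t x) \<le> M"
  obtains u where "u 0 = x0" "\<And>t. (u has_vector_derivative f t (u t)) (at t)"
proof -
  \<comment> \<open>More than twice the Lipschitz constant, so that \<open>lip'\<close> and the gain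
    \<open>1 / K\<close> together leave the contraction factor 1/2. The summand 1 keeps
    \<open>K\<close> positive when \<open>L\<close> is zero.\<close>
  define K where "K = 2 * (\<bar>L\<bar> + 1)"
  have K: "K > 0" by (simp add: K_def)
  have lip': "norm (f t x - f t y) \<le> K / 2 * norm (x - y)" for t x y
    by (rule order_trans[OF lip], rule mult_right_mono) (auto simp: K_def)
  have M: "M \<ge> 0" using bnd[of 0 0] norm_ge_zero order_trans by blast
  have "\<exists>H. H 0 = 0 \<and> (\<forall>t. (H has_vector_derivative h t) (at t))"
    if "continuous_on UNIV h" for h :: "real \<Rightarrow> 'a"
    using antiderivative_on_open_interval[OF open_UNIV is_interval_univ UNIV_I that, of 0] by auto
  then obtain A where A0: "\<And>h :: real \<Rightarrow> 'a. continuous_on UNIV h \<Longrightarrow> A h 0 = 0"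
    and A: "\<And>(h :: real \<Rightarrow> 'a) t. continuous_on UNIV h \<Longrightarrow> (A h has_vector_derivative h t) (at t)"
    by metis
  define h where "h w s = f s (exp (K * \<bar>s\<bar>) *\<^sub>R apply_bcontfun w s)" for w s
  have hcont: "continuous_on UNIV (h w)" for w
  proof -
    have "continuous_on UNIV (\<lambda>s. (\<lambda>p. f (fst p) (snd p)) (s, exp (K * \<bar>s\<bar>) *\<^sub>R apply_bcontfun w s))"
      by (rule continuous_on_compose2[OF cont]) (auto intro!: continuous_intros)
    thus ?thesis unfolding h_def by simp
  qed
  \<comment> \<open>\<open>w\<close> stands for a curve divided by the exponential weight,
    \<open>h w\<close> is the field along the curve itself, and \<open>P w\<close> is the weighted
    form of its Picard image. The bound \<open>M\<close> keeps \<open>P w\<close> bounded.\<close>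
  define P where "P w t = exp (- (K * \<bar>t\<bar>)) *\<^sub>R (x0 + A (h w) t)" for w t
  have P: "P w \<in> bcontfun" for w
  proof -
    have "continuous_on UNIV (A (h w))"
      using A[OF hcont] by (meson continuous_at_imp_continuous_on has_vector_derivative_continuous)
    hence "continuous_on UNIV (P w)"
      unfolding P_def by (auto intro!: continuous_intros)
    moreover have "norm (P w t) \<le> norm x0 + M / K" for t
    proof -
      have "norm (A (h w) t) \<le> M / K * exp (K * \<bar>t\<bar>)"
      proof (rule exp_derivative_imp_exp_bound[OF A[OF hcont] A0[OF hcont] K])
        show "norm (h w t) \<le> M * exp (K * \<bar>t\<bar>)" for t
          using mult_left_mono[OF one_le_exp_iff[THEN iffD2, of "K * \<bar>t\<bar>"] M] bnd[of t] K
          unfolding h_def by (smt (verit) mult_cancel_left1 mult_nonneg_nonneg abs_ge_zero)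
      qed
      hence "norm (x0 + A (h w) t) \<le> norm x0 + M / K * exp (K * \<bar>t\<bar>)"
        by (meson add_left_mono norm_triangle_ineq order_trans)
      hence "norm (P w t) \<le> exp (- (K * \<bar>t\<bar>)) * (norm x0 + M / K * exp (K * \<bar>t\<bar>))"
        unfolding P_def by simp
      also have "\<dots> = exp (- (K * \<bar>t\<bar>)) * norm x0 + M / K"
        by (simp add: algebra_simps exp_minus)
      also have "\<dots> \<le> norm x0 + M / K"
        using K by (simp add: mult_left_le_one_le)
      finally show ?thesis .
    qed
    hence "bounded (range (P w))" by (auto simp: bounded_iff)
    ultimately show ?thesis by (simp add: bcontfun_def)
  qed
  have "dist (Bcontfun (P v)) (Bcontfun (P w)) \<le> 1 / 2 * dist v w" for v w
  proof (rule dist_bound)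
    fix t
    define d where "d = dist v w"
    have "norm (A (h v) t - A (h w) t) \<le> (K / 2 * d) / K * exp (K * \<bar>t\<bar>)"
    proof (rule exp_derivative_imp_exp_bound[where g = "\<lambda>t. h v t - h w t"])
      show "((\<lambda>t. A (h v) t - A (h w) t) has_vector_derivative h v t - h w t) (at t)" for t
        by (auto intro!: derivative_eq_intros A hcont)
      show "norm (h v t - h w t) \<le> K / 2 * d * exp (K * \<bar>t\<bar>)" for t
      proof -
        have "norm (h v t - h w t) \<le> K / 2 * norm (exp (K * \<bar>t\<bar>) *\<^sub>R (apply_bcontfun v t - apply_bcontfun w t))"
          unfolding h_def using lip' by (metis scaleR_diff_right)
        also have "\<dots> = K / 2 * (exp (K * \<bar>t\<bar>) * dist (apply_bcontfun v t) (apply_bcontfun w t))"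
          by (simp add: dist_norm)
        also have "\<dots> \<le> K / 2 * (exp (K * \<bar>t\<bar>) * d)"
          using K unfolding d_def by (intro mult_left_mono dist_bounded) auto
        finally show ?thesis by (simp add: algebra_simps)
      qed
    qed (use A0[OF hcont] K in auto)
    also have "\<dots> = d / 2 * exp (K * \<bar>t\<bar>)" using K by simp
    finally have *: "norm (A (h v) t - A (h w) t) \<le> d / 2 * exp (K * \<bar>t\<bar>)" .
    have "dist (P v t) (P w t) = exp (- (K * \<bar>t\<bar>)) * norm (A (h v) t - A (h w) t)"
      by (simp add: P_def dist_norm scaleR_diff_right[symmetric])
    also have "\<dots> \<le> exp (- (K * \<bar>t\<bar>)) * (d / 2 * exp (K * \<bar>t\<bar>))"
      using * by (intro mult_left_mono) auto
    also have "\<dots> = d / 2" by (simp add: exp_minus)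
    finally show "dist (apply_bcontfun (Bcontfun (P v)) t) (apply_bcontfun (Bcontfun (P w)) t) \<le> 1 / 2 * dist v w"
      using P by (simp add: Bcontfun_inverse d_def)
  qed
  then obtain W where W: "Bcontfun (P W) = W"
    using banach_fix_type[of "1/2" "\<lambda>w. Bcontfun (P w)"] by auto
  define u where "u t = x0 + A (h W) t" for t
  have u: "u t = exp (K * \<bar>t\<bar>) *\<^sub>R apply_bcontfun W t" for t
  proof -
    have "apply_bcontfun W t = P W t" using P W by (metis Bcontfun_inverse)
    thus ?thesis by (simp add: P_def u_def exp_minus)
  qed
  have "(u has_vector_derivative f t (u t)) (at t)" for t
  proof -
    have "(u has_vector_derivative h W t) (at t)"
      unfolding u_def by (auto intro!: derivative_eq_intros A hcont)
    thus ?thesis by (simp add: h_def u)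
  qed
  moreover have "u 0 = x0" by (simp add: u_def A0 hcont)
  ultimately show thesis using that by blast
qed

section \<open>Gronwall and barrier estimates\<close>

lemma gronwall_norm:
  fixes w :: "real \<Rightarrow> 'a::real_inner"
  assumes "a \<le> b"
    and der: "\<And>t. a \<le> t \<Longrightarrow> t \<le> b \<Longrightarrow> (w has_vector_derivative w' t) (at t)"
    and bnd: "\<And>t. a \<le> t \<Longrightarrow> t \<le> b \<Longrightarrow> norm (w' t) \<le> L * norm (w t)"
  shows "norm (w b) \<le> exp (L * (b - a)) * norm (w a)"
    and "norm (w a) \<le> exp (L * (b - a)) * norm (w b)"
proof -
  \<comment> \<open>The squared norm is differentiable even where \<open>w\<close> vanishes. The
    factor \<open>exp (- (2 * L) * t)\<close> makes it nonincreasing, which gives the forward bound;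
    \<open>exp (2 * L * t)\<close> makes it nondecreasing, which gives the backward one.\<close>
  define N where "N t = w t \<bullet> w t" for t
  have N: "(N has_real_derivative 2 * (w t \<bullet> w' t)) (at t)" if "a \<le> t" "t \<le> b" for t
  proof -
    have "(w has_derivative (\<lambda>h. h *\<^sub>R w' t)) (at t)"
      using der[OF that] by (simp add: has_vector_derivative_def)
    from has_derivative_inner[OF this this] show ?thesis
      unfolding N_def has_field_derivative_def
      by (rule has_derivative_eq_rhs) (auto simp: fun_eq_iff inner_commute)
  qed
  have est: "\<bar>w t \<bullet> w' t\<bar> \<le> L * N t" if "a \<le> t" "t \<le> b" for t
  proof -
    have "\<bar>w t \<bullet> w' t\<bar> \<le> norm (w t) * norm (w' t)" by (rule Cauchy_Schwarz_ineq2)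
    also have "\<dots> \<le> norm (w t) * (L * norm (w t))"
      using bnd[OF that] by (intro mult_left_mono) auto
    also have "\<dots> = L * N t" by (simp add: N_def power2_norm_eq_inner[symmetric] power2_eq_square)
    finally show ?thesis .
  qed
  have Nn: "N t = (norm (w t))\<^sup>2" for t by (simp add: N_def power2_norm_eq_inner)
  have "exp (- (2 * L) * b) * N b \<le> exp (- (2 * L) * a) * N a"
  proof (rule DERIV_nonpos_imp_nonincreasing[OF \<open>a \<le> b\<close>])
    fix t assume t: "a \<le> t" "t \<le> b"
    have "((\<lambda>t. exp (- (2 * L) * t) * N t) has_real_derivative
        exp (- (2 * L) * t) * (2 * (w t \<bullet> w' t - L * N t))) (at t)"
      using t by (auto intro!: derivative_eq_intros N simp: algebra_simps)
    moreover have "exp (- (2 * L) * t) * (2 * (w t \<bullet> w' t - L * N t)) \<le> 0"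
      using est[OF t] by (intro mult_nonneg_nonpos) auto
    ultimately show "\<exists>y. ((\<lambda>t. exp (- (2 * L) * t) * N t) has_real_derivative y) (at t) \<and> y \<le> 0"
      by blast
  qed
  hence "exp (2 * L * b) * (exp (- (2 * L) * b) * N b) \<le> exp (2 * L * b) * (exp (- (2 * L) * a) * N a)"
    by (intro mult_left_mono) auto
  moreover have "exp (2 * L * b) * (exp (- (2 * L) * b) * N b) = N b"
    by (simp add: exp_minus)
  moreover have "exp (2 * L * b) * (exp (- (2 * L) * a) * N a) = (exp (L * (b - a)))\<^sup>2 * N a"
  proof -
    have "exp (2 * L * b) * exp (- (2 * L) * a) = (exp (L * (b - a)))\<^sup>2"
      unfolding exp_double[symmetric] exp_add[symmetric] by (simp add: algebra_simps)
    thus ?thesis by simp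
  qed
  ultimately have "N b \<le> (exp (L * (b - a)))\<^sup>2 * N a" by linarith
  hence "(norm (w b))\<^sup>2 \<le> (exp (L * (b - a)) * norm (w a))\<^sup>2"
    by (simp add: Nn power_mult_distrib)
  thus "norm (w b) \<le> exp (L * (b - a)) * norm (w a)"
    by (rule power2_le_imp_le) auto
  have "exp (2 * L * a) * N a \<le> exp (2 * L * b) * N b"
  proof (rule DERIV_nonneg_imp_nondecreasing[OF \<open>a \<le> b\<close>])
    fix t assume t: "a \<le> t" "t \<le> b"
    have "((\<lambda>t. exp (2 * L * t) * N t) has_real_derivative
        exp (2 * L * t) * (2 * (w t \<bullet> w' t + L * N t))) (at t)"
      using t by (auto intro!: derivative_eq_intros N simp: algebra_simps)
    moreover have "exp (2 * L * t) * (2 * (w t \<bullet> w' t + L * N t)) \<ge> 0"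
      using est[OF t] by (intro mult_nonneg_nonneg) auto
    ultimately show "\<exists>y. ((\<lambda>t. exp (2 * L * t) * N t) has_real_derivative y) (at t) \<and> 0 \<le> y"
      by blast
  qed
  hence "exp (- (2 * L * a)) * (exp (2 * L * a) * N a) \<le> exp (- (2 * L * a)) * (exp (2 * L * b) * N b)"
    by (intro mult_left_mono) auto
  moreover have "exp (- (2 * L * a)) * (exp (2 * L * a) * N a) = N a"
    by (simp add: exp_minus)
  moreover have "exp (- (2 * L * a)) * (exp (2 * L * b) * N b) = (exp (L * (b - a)))\<^sup>2 * N b"
  proof -
    have "exp (- (2 * L * a)) * exp (2 * L * b) = (exp (L * (b - a)))\<^sup>2"
      unfolding exp_double[symmetric] exp_add[symmetric] by (simp add: algebra_simps)
    thus ?thesis by simp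
  qed
  ultimately have "N a \<le> (exp (L * (b - a)))\<^sup>2 * N b" by linarith
  hence "(norm (w a))\<^sup>2 \<le> (exp (L * (b - a)) * norm (w b))\<^sup>2"
    by (simp add: Nn power_mult_distrib)
  thus "norm (w a) \<le> exp (L * (b - a)) * norm (w b)"
    by (rule power2_le_imp_le) auto
qed

text \<open>After the last time at which \<open>u\<close> is at most \<open>c\<close>, it lies
  strictly above \<open>c\<close>, where it cannot increase; so it could never have risen to a value
  above \<open>c\<close> at \<open>b\<close>.\<close>

lemma barrier_upper:
  fixes u :: "real \<Rightarrow> real"
  assumes "a \<le> b" "u a \<le> c"
    and der: "\<And>t. a \<le> t \<Longrightarrow> t \<le> b \<Longrightarrow> (u has_real_derivative u' t) (at t)"
    and neg: "\<And>t. a \<le> t \<Longrightarrow> t \<le> b \<Longrightarrow> u t > c \<Longrightarrow> u' t \<le> 0"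
  shows "u b \<le> c"
proof (rule ccontr)
  assume ub: "\<not> u b \<le> c"
  define S where "S = {t \<in> {a..b}. u t \<le> c}"
  have cont: "continuous_on {a..b} u"
    using der by (meson DERIV_isCont atLeastAtMost_iff continuous_at_imp_continuous_on)
  have "closed S" unfolding S_def
    by (intro continuous_on_closed_Collect_le cont) (auto intro!: continuous_intros)
  moreover have "bounded S"
    by (rule bounded_subset[of "{a..b}"]) (auto simp: S_def)
  ultimately have "compact S" by (simp add: compact_eq_bounded_closed)
  moreover have "S \<noteq> {}" using assms by (auto simp: S_def)
  ultimately obtain s where s: "s \<in> S" "\<forall>t\<in>S. t \<le> s" using compact_attains_sup by blast
  hence sb: "a \<le> s" "s < b" "u s \<le> c" using ub by (auto simp: S_def order_le_less)
  have "u b \<le> u s"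
  proof (rule DERIV_nonpos_imp_decreasing_open[of s b u])
    show "s \<le> b" using sb by simp
    show "\<exists>y. (u has_real_derivative y) (at t) \<and> y \<le> 0" if "s < t" "t < b" for t
    proof -
      have "t \<notin> S" using s(2) that(1) by (auto simp: not_le[symmetric])
      hence "u t > c" using that sb by (auto simp: S_def)
      thus ?thesis using der[of t] neg[of t] that sb by auto
    qed
    show "continuous_on {s..b} u" using continuous_on_subset[OF cont] sb by auto
  qed
  thus False using ub sb by simp
qed

section \<open>Uniqueness at the equilibrium and continuation of bounded solutions\<close>

lemma solution_zero:
  fixes f :: "'a::real_inner \<Rightarrow> 'a"
  assumes sol: "is_solution f I \<gamma>" and "f 0 = 0"
    and lip: "\<And>R. \<exists>L. L-lipschitz_on (cball 0 R) f"
    and "s \<in> I" "t \<in> I" "\<gamma> s = 0"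
  shows "\<gamma> t = 0"
proof -
  define a where "a = min s t"
  define b where "b = max s t"
  have "a \<in> I" "b \<in> I" using \<open>s \<in> I\<close> \<open>t \<in> I\<close> by (auto simp: a_def b_def min_def max_def)
  hence ab: "a \<le> b" "{a..b} \<subseteq> I"
    using sol mem_is_interval_1_I[of I a b] by (auto simp: is_solution_def a_def b_def)
  have der: "(\<gamma> has_vector_derivative f (\<gamma> r)) (at r)" if "a \<le> r" "r \<le> b" for r
    using sol ab that by (auto simp: is_solution_def)
  hence "continuous_on {a..b} \<gamma>"
    by (meson atLeastAtMost_iff continuous_at_imp_continuous_on has_vector_derivative_continuous)
  hence "compact (\<gamma> ` {a..b})" by (rule compact_continuous_image) simp
  then obtain R where R: "\<And>r. a \<le> r \<Longrightarrow> r \<le> b \<Longrightarrow> norm (\<gamma> r) \<le> R"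
    using compact_imp_bounded by (fastforce simp: bounded_iff)
  obtain L where L: "L-lipschitz_on (cball 0 R) f" using lip by blast
  \<comment> \<open>As \<open>f\<close> vanishes at 0, its Lipschitz bound on a ball containing the
    compact arc controls the speed by the norm. Gronwall in either time direction then carries the
    zero from \<open>s\<close> to \<open>t\<close>.\<close>
  have bnd: "norm (f (\<gamma> r)) \<le> L * norm (\<gamma> r)" if "a \<le> r" "r \<le> b" for r
  proof -
    have "0 \<le> R" using R[OF that] norm_ge_zero order_trans by blast
    thus ?thesis using lipschitz_on_normD[OF L, of "\<gamma> r" 0] R[OF that] \<open>f 0 = 0\<close> by simp
  qed
  from gronwall_norm[OF ab(1) der bnd] \<open>\<gamma> s = 0\<close> show ?thesis
    unfolding a_def b_def by (auto simp: min_def max_def split: if_splits)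
qed

text \<open>If the domain ended at a finite time \<open>b\<close>, the bounded solution could be
  continued past \<open>b\<close>, against maximality. The continuation solves the equation of a
  truncated field, to which \<open>picard_global\<close> applies.\<close>

lemma maximal_solution_bounded_forward:
  fixes f :: "'a::euclidean_space \<Rightarrow> 'a"
  assumes max: "maximal_solution f I \<gamma>"
    and lip: "\<And>R. \<exists>L. L-lipschitz_on (cball 0 R) f"
    and t0: "t0 \<in> I" and bnd: "\<And>t. t \<in> I \<Longrightarrow> t0 \<le> t \<Longrightarrow> norm (\<gamma> t) \<le> R"
  shows "{t0..} \<subseteq> I"
proof (rule ccontr)
  assume "\<not> {t0..} \<subseteq> I"
  then obtain t1 where t1: "t0 \<le> t1" "t1 \<notin> I" by auto
  have sol: "open I" "is_interval I" "\<And>t. t \<in> I \<Longrightarrow> (\<gamma> has_vector_derivative f (\<gamma> t)) (at t)"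
    using max by (auto simp: maximal_solution_def is_solution_def)
  have I: "s \<in> I" if "r \<in> I" "r \<le> s" "s \<le> t" "t \<in> I" for r s t
    using sol(2) that unfolding is_interval_1 by blast
  have upper: "t \<le> t1" if "t \<in> I" for t using I[OF t0 t1(1) _ that] t1(2) by (meson linear)
  hence bdd: "bdd_above I" by (auto simp: bdd_above_def)
  define b where "b = Sup I"
  have le_b: "t \<le> b" if "t \<in> I" for t unfolding b_def using that bdd by (rule cSup_upper)
  have b: "b \<notin> I"
  proof
    assume "b \<in> I"
    then obtain e where "e > 0" "cball b e \<subseteq> I" using sol(1) open_contains_cball by blast
    hence "b + e \<in> I" by (auto simp: dist_real_def subset_iff)
    thus False using le_b \<open>e > 0\<close> by fastforce
  qed
  have lt_b: "t < b" if "t \<in> I" for t using le_b[OF that] b that by (cases "t = b") auto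
  have in_I: "t \<in> I" if t: "t0 \<le> t" "t < b" for t
  proof -
    obtain s where "s \<in> I" "t < s"
      using t(2) less_cSup_iff[OF _ bdd] t0 unfolding b_def by blast
    thus ?thesis using I[OF t0 t(1)] by (meson less_imp_le)
  qed
  have R: "0 \<le> R" using bnd[OF t0] norm_ge_zero order_trans by blast
  \<comment> \<open>Projecting onto this ball makes the field globally bounded and Lipschitz. The
    margin 1 over \<open>R\<close> lets the continued solution stay where \<open>g\<close> and
    \<open>f\<close> agree for a while after \<open>b\<close>.\<close>
  define B where "B = cball (0::'a) (R + 1)"
  have B: "convex B" "closed B" "B \<noteq> {}" using R by (auto simp: B_def)
  define g where "g v = f (closest_point B v)" for v
  have gf: "g v = f v" if "norm v \<le> R + 1" for v
    using that by (simp add: g_def B_def closest_point_self)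
  obtain L where L: "L-lipschitz_on B f" using lip unfolding B_def by blast
  have glip: "norm (g v - g w) \<le> L * norm (v - w)" for v w
  proof -
    have "norm (g v - g w) \<le> L * norm (closest_point B v - closest_point B w)"
      unfolding g_def using B by (intro lipschitz_on_normD[OF L] closest_point_in_set)
    also have "\<dots> \<le> L * norm (v - w)"
      using closest_point_lipschitz[OF B] lipschitz_on_nonneg[OF L]
      by (intro mult_left_mono) (auto simp: dist_norm)
    finally show ?thesis .
  qed
  have gbnd: "norm (g v) \<le> norm (f 0) + L * (R + 1)" for v
  proof -
    have "closest_point B v \<in> B" using B by (intro closest_point_in_set)
    hence "norm (closest_point B v - 0) \<le> R + 1" by (simp add: B_def)
    hence "norm (f (closest_point B v) - f 0) \<le> L * (R + 1)"
      using lipschitz_on_normD[OF L \<open>closest_point B v \<in> B\<close>, of 0] R lipschitz_on_nonneg[OF L]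
      by (smt (verit) B_def mem_cball_0 norm_zero mult_left_mono)
    thus ?thesis unfolding g_def using norm_triangle_sub[of "f (closest_point B v)" "f 0"] by simp
  qed
  have "L-lipschitz_on UNIV g"
    by (rule lipschitz_onI) (use glip lipschitz_on_nonneg[OF L] in \<open>auto simp: dist_norm\<close>)
  hence "continuous_on UNIV g" by (rule lipschitz_on_continuous_on)
  hence "continuous_on UNIV (\<lambda>p::real \<times> 'a. g (snd p))"
    by (rule continuous_on_compose2) (auto intro!: continuous_intros)
  from picard_global[where f = "\<lambda>_. g", OF this glip gbnd] obtain u
    where u: "u 0 = \<gamma> t0" "\<And>t. (u has_vector_derivative g (u t)) (at t)" by metis
  define w where "w t = u (t - t0)" for t
  have w: "(w has_vector_derivative g (w t)) (at t)" for t
  proof -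
    have "((u \<circ> (\<lambda>t. t - t0)) has_vector_derivative 1 *\<^sub>R g (w t)) (at t)"
      by (rule vector_diff_chain_at) (auto intro!: derivative_eq_intros u(2) simp: w_def)
    thus ?thesis by (simp add: w_def[abs_def] o_def)
  qed
  have wcont: "isCont w t" for t using w has_vector_derivative_continuous by blast
  have eq: "w t = \<gamma> t" if t: "t0 \<le> t" "t < b" for t
  proof -
    have "norm (w t - \<gamma> t) \<le> exp (L * (t - t0)) * norm (w t0 - \<gamma> t0)"
    proof (rule gronwall_norm(1)[OF t(1)])
      fix s assume s: "t0 \<le> s" "s \<le> t"
      have sI: "s \<in> I" using in_I s t by auto
      show "((\<lambda>s. w s - \<gamma> s) has_vector_derivative g (w s) - f (\<gamma> s)) (at s)"
        by (intro derivative_intros w sol(3)[OF sI])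
      show "norm (g (w s) - f (\<gamma> s)) \<le> L * norm (w s - \<gamma> s)"
        using glip[of "w s" "\<gamma> s"] gf[of "\<gamma> s"] bnd[OF sI s(1)] by simp
    qed
    thus ?thesis by (simp add: w_def u(1))
  qed
  have t0b: "t0 < b" using lt_b t0 .
  have wb: "norm (w b) \<le> R"
  proof (rule tendsto_upperbound)
    show "((\<lambda>t. norm (w t)) \<longlongrightarrow> norm (w b)) (at_left b)"
      using wcont[of b] by (intro tendsto_norm) (auto simp: isCont_def filterlim_at_split)
    show "\<forall>\<^sub>F t in at_left b. norm (w t) \<le> R"
      using eventually_at_left_real[OF t0b]
      by eventually_elim (use eq bnd in_I in auto)
  qed simp
  obtain e where e: "e > 0" "\<And>t. dist t b < e \<Longrightarrow> dist (w t) (w b) < 1"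
    using wcont[of b] unfolding continuous_at_eps_delta by (metis zero_less_one)
  have wsmall: "norm (w t) \<le> R + 1" if "t0 < t" "t < b + e" for t
  proof (cases "t < b")
    case True
    thus ?thesis using eq[of t] bnd[of t] in_I[of t] that by auto
  next
    case False
    hence "dist (w t) (w b) < 1" using that e by (auto simp: dist_real_def)
    thus ?thesis using wb norm_triangle_sub[of "w t" "w b"] by (simp add: dist_norm)
  qed
  define v where "v t = (if t < b then \<gamma> t else w t)" for t
  \<comment> \<open>The right piece starts at \<open>t0\<close> rather than at \<open>b\<close>, so
    that it is open and overlaps \<open>I\<close>; on the overlap both curves coincide.\<close>
  define J where "J = I \<union> {t0<..<b + e}"
  have "is_solution f J v"
    unfolding is_solution_def
  proof (intro conjI ballI)
    show "open J" using sol by (auto simp: J_def)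
    have "connected J" unfolding J_def
    proof (rule connected_Un)
      have "(t0 + b) / 2 \<in> I \<inter> {t0<..<b + e}" using in_I t0b e by auto
      thus "I \<inter> {t0<..<b + e} \<noteq> {}" by blast
    qed (use sol in \<open>auto simp: is_interval_connected_1\<close>)
    thus "is_interval J" by (simp add: is_interval_connected_1)
    show "J \<noteq> {}" using t0 by (auto simp: J_def)
    fix t assume "t \<in> J"
    then consider "t \<in> I" | "t \<in> {t0<..<b + e}" by (auto simp: J_def)
    thus "(v has_vector_derivative f (v t)) (at t)"
    proof cases
      case 1
      have "(v has_vector_derivative f (\<gamma> t)) (at t)"
        by (rule has_vector_derivative_transform_within_open[OF sol(3)[OF 1] sol(1) 1])
           (use lt_b in \<open>auto simp: v_def\<close>)
      thus ?thesis using lt_b[OF 1] by (simp add: v_def)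
    next
      case 2
      have vw: "w s = v s" if "s \<in> {t0<..<b + e}" for s
        using that eq by (auto simp: v_def)
      have "(v has_vector_derivative g (w t)) (at t)"
        by (rule has_vector_derivative_transform_within_open[OF w _ 2]) (use vw in auto)
      thus ?thesis using vw[OF 2] gf wsmall[of t] 2 by simp
    qed
  qed
  moreover have "I \<subseteq> J" "\<forall>t\<in>I. v t = \<gamma> t" using lt_b by (auto simp: J_def v_def)
  ultimately have "J = I" using max unfolding maximal_solution_def by blast
  moreover have "b \<in> J" using t0b e by (auto simp: J_def)
  ultimately show False using b by simp
qed

section \<open>The periodic profile\<close>

definition sg :: "real \<Rightarrow> real" where
  "sg p = sin p * cos p"

text \<open>Up to the positive factor \<open>z\<close> this is the angular speed of an orbit. It is
  affine in \<open>z\<close>, which later makes the equation of the ratio \<open>z / Z\<close> close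
  up.\<close>

definition ang :: "real \<Rightarrow> real \<Rightarrow> real \<Rightarrow> real" where
  "ang \<epsilon> p z = z + \<epsilon> * sg p * (z - (1 - sg p))"

lemma sg_bounds: "\<bar>sg p\<bar> \<le> 1/2" "- (1/2) \<le> sg p" "sg p \<le> 1/2" "\<bar>sg p\<bar> \<le> \<bar>sin p\<bar>"
proof -
  have "2 * sg p = sin (2 * p)" by (simp add: sg_def sin_double)
  hence "\<bar>2 * sg p\<bar> \<le> 1" by simp
  thus "\<bar>sg p\<bar> \<le> 1/2" "- (1/2) \<le> sg p" "sg p \<le> 1/2" by linarith+
  show "\<bar>sg p\<bar> \<le> \<bar>sin p\<bar>"
    by (simp add: sg_def abs_mult mult_left_le)
qed

lemma sg_add_pi [simp]: "sg (p + pi) = sg p"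
  by (simp add: sg_def)

lemma DERIV_sg: "(sg has_real_derivative 1 - 2 * (sin p)\<^sup>2) (at p)"
proof -
  have "((\<lambda>p. sin p * cos p) has_real_derivative 1 - 2 * (sin p)\<^sup>2) (at p)"
    by (auto intro!: derivative_eq_intros simp: power2_eq_square[symmetric] cos_squared_eq)
  thus ?thesis unfolding sg_def[abs_def] .
qed

section \<open>The modified scalar equation and its bounds\<close>

lemma quotient_diff_le:
  fixes n1 n2 m1 m2 :: real
  assumes "\<delta> > 0" "\<delta> \<le> m1" "\<delta> \<le> m2" "\<bar>n1\<bar> \<le> N" "\<bar>n1 - n2\<bar> \<le> a" "\<bar>m1 - m2\<bar> \<le> b"
  shows "\<bar>n1 / m1 - n2 / m2\<bar> \<le> N * b / \<delta>\<^sup>2 + a / \<delta>"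
proof -
  have m: "m1 > 0" "m2 > 0" using assms by auto
  have "n1 / m1 - n2 / m2 = n1 * (m2 - m1) / (m1 * m2) + (n1 - n2) / m2"
    using m by (simp add: field_simps)
  also have "\<bar>\<dots>\<bar> \<le> \<bar>n1 * (m2 - m1) / (m1 * m2)\<bar> + \<bar>(n1 - n2) / m2\<bar>" by (rule abs_triangle_ineq)
  also have "\<bar>n1 * (m2 - m1) / (m1 * m2)\<bar> = \<bar>n1\<bar> * \<bar>m1 - m2\<bar> / (m1 * m2)"
    using m by (simp add: abs_mult abs_minus_commute)
  also have "\<dots> \<le> N * b / (\<delta> * \<delta>)"
    using assms m by (intro frac_le mult_mono) auto
  also have "\<bar>(n1 - n2) / m2\<bar> = \<bar>n1 - n2\<bar> / m2" using m by simp
  also have "\<dots> \<le> a / \<delta>"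
    using assms by (intro frac_le) auto
  finally show ?thesis by (simp add: power2_eq_square)
qed

locale planar_parameter =
  fixes \<epsilon> :: real
  assumes eps: "\<epsilon> > 0"
begin

text \<open>The level at which \<open>ang\<close> is stopped from decreasing. With 1/4, a value of
  \<open>ang\<close> below \<delta> forces \<epsilon> \<bar>sin p\<bar> \<ge> 1/4; with the second
  entry, \<open>slope\<close> is then large enough to push \<open>ang\<close> up again (see
  \<open>ang_derivative_nonneg\<close>).\<close>

definition \<delta> :: real where "\<delta> = min (1/4) (1 / (96 * \<epsilon>\<^sup>2))"

text \<open>The ends 1/2 and 3/2 are the extreme values of \<open>1 - sg p\<close>, so at each end
  the factor \<open>clip z - (1 - sg p)\<close> of \<open>slope\<close> keeps one sign for all
  \<open>p\<close>.\<close>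

definition clip :: "real \<Rightarrow> real" where "clip z = max (1/2) (min z (3/2))"

text \<open>The slope \<open>dz/dp\<close> of orbits in the coordinates of the file header, modified outside the
  trapping region \<open>1/2 \<le> z \<le> 3/2\<close>, \<open>ang \<epsilon> p z \<ge> \<delta>\<close> so that it is bounded and globally
  Lipschitz.\<close>

definition slope :: "real \<Rightarrow> real \<Rightarrow> real" where
  "slope p z = - 2 * \<epsilon> * (sin p)\<^sup>2 * clip z * (clip z - (1 - sg p)) / max \<delta> (ang \<epsilon> p (clip z))"

lemma delta: "\<delta> > 0" "\<delta> \<le> 1/4" "\<delta> \<le> 1 / (96 * \<epsilon>\<^sup>2)"
  using eps by (auto simp: \<delta>_def)

lemma clip: "1/2 \<le> clip z" "clip z \<le> 3/2" "\<bar>clip z - clip w\<bar> \<le> \<bar>z - w\<bar>"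
  "1/2 \<le> z \<Longrightarrow> z \<le> 3/2 \<Longrightarrow> clip z = z" "3/2 \<le> z \<Longrightarrow> clip z = 3/2" "z \<le> 1/2 \<Longrightarrow> clip z = 1/2"
  by (auto simp: clip_def max_def min_def)

lemma slope_numerator_bound:
  "\<bar>- 2 * \<epsilon> * (sin p)\<^sup>2 * clip z * (clip z - (1 - sg p))\<bar> \<le> 3 * \<epsilon>"
proof -
  have "\<bar>clip z * (clip z - (1 - sg p))\<bar> \<le> 3/2 * 1"
    unfolding abs_mult using clip(1,2)[of z] sg_bounds[of p] by (intro mult_mono) auto
  hence "(2 * \<epsilon> * (sin p)\<^sup>2) * \<bar>clip z * (clip z - (1 - sg p))\<bar> \<le> (2 * \<epsilon> * 1) * (3/2)"
    using eps by (intro mult_mono) (auto simp: abs_square_le_1)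
  thus ?thesis using eps by (simp add: abs_mult mult.assoc)
qed

lemma slope_bound: "\<bar>slope p z\<bar> \<le> 3 * \<epsilon> / \<delta>"
proof -
  have "\<bar>slope p z\<bar> = \<bar>- 2 * \<epsilon> * (sin p)\<^sup>2 * clip z * (clip z - (1 - sg p))\<bar> / max \<delta> (ang \<epsilon> p (clip z))"
    using delta unfolding slope_def by (simp add: abs_divide)
  also have "\<dots> \<le> 3 * \<epsilon> / \<delta>"
    using delta eps slope_numerator_bound[of p z] by (intro frac_le) auto
  finally show ?thesis .
qed

lemma slope_lipschitz:
  obtains L where "L > 0" "\<And>p z w. \<bar>slope p z - slope p w\<bar> \<le> L * \<bar>z - w\<bar>"
proof
  show "3 * \<epsilon> * (1 + \<epsilon>) / \<delta>\<^sup>2 + 6 * \<epsilon> / \<delta> > 0"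
    using eps delta by (intro add_pos_pos) auto
  fix p z w
  have n: "\<bar>(- 2 * \<epsilon> * (sin p)\<^sup>2 * clip z * (clip z - (1 - sg p)))
      - (- 2 * \<epsilon> * (sin p)\<^sup>2 * clip w * (clip w - (1 - sg p)))\<bar> \<le> 6 * \<epsilon> * \<bar>z - w\<bar>"
  proof -
    have "(- 2 * \<epsilon> * (sin p)\<^sup>2 * clip z * (clip z - (1 - sg p)))
      - (- 2 * \<epsilon> * (sin p)\<^sup>2 * clip w * (clip w - (1 - sg p)))
      = - (2 * \<epsilon> * (sin p)\<^sup>2 * ((clip z - clip w) * (clip z + clip w - (1 - sg p))))"
      by (simp add: algebra_simps)
    moreover have "\<bar>(clip z - clip w) * (clip z + clip w - (1 - sg p))\<bar> \<le> \<bar>z - w\<bar> * 3"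
      unfolding abs_mult using clip(1,2)[of z] clip(1,2)[of w] clip(3)[of z w] sg_bounds[of p]
      by (intro mult_mono) auto
    hence "(2 * \<epsilon> * (sin p)\<^sup>2) * \<bar>(clip z - clip w) * (clip z + clip w - (1 - sg p))\<bar>
        \<le> (2 * \<epsilon> * 1) * (\<bar>z - w\<bar> * 3)"
      using eps by (intro mult_mono) (auto simp: abs_square_le_1)
    ultimately show ?thesis using eps by (simp add: abs_mult)
  qed
  have m: "\<bar>max \<delta> (ang \<epsilon> p (clip z)) - max \<delta> (ang \<epsilon> p (clip w))\<bar> \<le> (1 + \<epsilon>) * \<bar>z - w\<bar>"
  proof -
    have "\<bar>max \<delta> (ang \<epsilon> p (clip z)) - max \<delta> (ang \<epsilon> p (clip w))\<bar> \<le> \<bar>ang \<epsilon> p (clip z) - ang \<epsilon> p (clip w)\<bar>"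
      by (auto simp: max_def)
    also have "ang \<epsilon> p (clip z) - ang \<epsilon> p (clip w) = (1 + \<epsilon> * sg p) * (clip z - clip w)"
      by (simp add: ang_def algebra_simps)
    also have "\<bar>\<dots>\<bar> \<le> (1 + \<epsilon>) * \<bar>z - w\<bar>"
    proof -
      have "\<bar>\<epsilon> * sg p\<bar> \<le> \<epsilon> * 1" unfolding abs_mult
        using eps sg_bounds(1)[of p] by (intro mult_mono) auto
      hence "\<bar>1 + \<epsilon> * sg p\<bar> \<le> 1 + \<epsilon>" by linarith
      thus ?thesis unfolding abs_mult using clip(3) by (intro mult_mono) auto
    qed
    finally show ?thesis .
  qed
  have "\<bar>slope p z - slope p w\<bar> \<le> 3 * \<epsilon> * ((1 + \<epsilon>) * \<bar>z - w\<bar>) / \<delta>\<^sup>2 + 6 * \<epsilon> * \<bar>z - w\<bar> / \<delta>"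
    unfolding slope_def
    by (rule quotient_diff_le[OF delta(1) _ _ slope_numerator_bound n m]) auto
  thus "\<bar>slope p z - slope p w\<bar> \<le> (3 * \<epsilon> * (1 + \<epsilon>) / \<delta>\<^sup>2 + 6 * \<epsilon> / \<delta>) * \<bar>z - w\<bar>"
    by (simp add: algebra_simps)
qed

lemma slope_continuous: "continuous_on UNIV (\<lambda>p. slope (fst p) (snd p))"
proof -
  have "max \<delta> x \<noteq> 0" for x using delta by (auto simp: max_def)
  thus ?thesis unfolding slope_def ang_def sg_def clip_def
    by (intro continuous_intros) auto
qed

lemma slope_periodic: "slope (p + pi) z = slope p z"
  by (simp add: slope_def ang_def)

section \<open>The trapping region\<close>

lemma slope_trap:
  "z \<ge> 3/2 \<Longrightarrow> slope p z \<le> 0" "z \<le> 1/2 \<Longrightarrow> slope p z \<ge> 0"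
proof -
  have m: "max \<delta> x \<ge> 0" for x using delta by (auto simp: max_def)
  show "slope p z \<le> 0" if "z \<ge> 3/2"
    unfolding slope_def using that eps sg_bounds(2,3)[of p]
    by (intro divide_nonpos_nonneg m mult_nonpos_nonneg) (auto simp: clip)
  show "slope p z \<ge> 0" if "z \<le> 1/2"
    unfolding slope_def using that eps sg_bounds(2,3)[of p]
    by (intro divide_nonneg_nonneg m mult_nonpos_nonpos) (auto simp: clip)
qed

text \<open>The expression is the derivative of \<open>ang\<close> along a solution of the modified
  equation. Where \<open>ang\<close> is below \<delta>, \<open>slope\<close> has denominator
  \<delta>, so the first summand is at least 3/2 \<epsilon>, while the second is at most 3/2
  \<epsilon> in absolute value.\<close>

lemma ang_derivative_nonneg:
  assumes z: "1/2 \<le> z" "z \<le> 3/2" and small: "ang \<epsilon> p z < \<delta>"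
  shows "0 \<le> slope p z * (1 + \<epsilon> * sg p) + \<epsilon> * (1 - 2 * (sin p)\<^sup>2) * (z - (1 - sg p) + sg p)"
proof -
  have "\<epsilon> * sg p * (z - (1 - sg p)) < - (1/4)"
    using small z delta(2) by (simp add: ang_def)
  hence "1/4 \<le> \<bar>\<epsilon> * sg p * (z - (1 - sg p))\<bar>" by linarith
  also have "\<dots> \<le> \<epsilon> * \<bar>sin p\<bar> * 1"
    unfolding abs_mult using eps z sg_bounds[of p] by (intro mult_mono) auto
  finally have "(1/4)\<^sup>2 \<le> (\<epsilon> * \<bar>sin p\<bar>)\<^sup>2" by (intro power_mono) auto
  hence s: "1/16 \<le> \<epsilon>\<^sup>2 * (sin p)\<^sup>2" by (simp add: power_mult_distrib power_one_over)
  \<comment> \<open>Multiplied by \<open>1 + \<epsilon> * sg p\<close>, the deviation of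
    \<open>z\<close> from \<open>1 - sg p\<close> depends on \<open>z\<close> only through
    \<open>ang\<close>. A value of \<open>ang\<close> below 1/4 therefore makes it at most -1/4,
    since \<open>1 - sg p\<close> is at least 1/2.\<close>
  have e: "(z - (1 - sg p)) * (1 + \<epsilon> * sg p) = ang \<epsilon> p z - (1 - sg p)"
    by (simp add: ang_def algebra_simps)
  have "slope p z * (1 + \<epsilon> * sg p) = 2 * \<epsilon> * (sin p)\<^sup>2 * z * - ((z - (1 - sg p)) * (1 + \<epsilon> * sg p)) / \<delta>"
    using small z by (simp add: slope_def clip)
  also have "\<dots> = 2 * \<epsilon> * (sin p)\<^sup>2 * z * (1 - sg p - ang \<epsilon> p z) / \<delta>"
    unfolding e by simp
  also have "\<dots> \<ge> 2 * \<epsilon> * (sin p)\<^sup>2 * (1/2) * (1/4) / \<delta>"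
    using eps z small delta(1,2) sg_bounds[of p] by (intro divide_right_mono mult_mono) auto
  finally have 1: "slope p z * (1 + \<epsilon> * sg p) \<ge> \<epsilon> * (sin p)\<^sup>2 / (4 * \<delta>)" by simp
  have "\<epsilon> * (sin p)\<^sup>2 / (4 * \<delta>) \<ge> 3/2 * \<epsilon>"
  proof -
    have "6 * \<delta> \<le> 6 * (1 / (96 * \<epsilon>\<^sup>2))" using delta by simp
    also have "\<dots> = 1/16 / \<epsilon>\<^sup>2" by simp
    also have "\<dots> \<le> \<epsilon>\<^sup>2 * (sin p)\<^sup>2 / \<epsilon>\<^sup>2" using s by (intro divide_right_mono) auto
    also have "\<dots> = (sin p)\<^sup>2" using eps by simp
    finally have "\<epsilon> * (6 * \<delta>) \<le> \<epsilon> * (sin p)\<^sup>2" using eps by (intro mult_left_mono) auto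
    thus ?thesis using delta by (simp add: field_simps)
  qed
  moreover have "\<bar>\<epsilon> * (1 - 2 * (sin p)\<^sup>2) * (z - (1 - sg p) + sg p)\<bar> \<le> \<epsilon> * 1 * (3/2)"
  proof -
    have "(sin p)\<^sup>2 \<le> 1" "0 \<le> (sin p)\<^sup>2" by (auto simp: abs_square_le_1)
    hence "\<bar>1 - 2 * (sin p)\<^sup>2\<bar> \<le> 1" by linarith
    moreover have "\<bar>z - (1 - sg p) + sg p\<bar> \<le> 3/2" using z sg_bounds(2,3)[of p] by linarith
    ultimately show ?thesis
      unfolding abs_mult using eps by (intro mult_mono) auto
  qed
  ultimately show ?thesis using 1 by linarith
qed

text \<open>Three barriers: the first two confine the solution to the strip, and the third uses the
  strip to keep \<open>ang\<close> above \<delta>.\<close>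

lemma slope_solution_trapped:
  assumes u: "\<And>p. (u has_real_derivative slope p (u p)) (at p)"
    and u0: "1/2 \<le> u 0" "u 0 \<le> 3/2" and "p \<ge> 0"
  shows "1/2 \<le> u p" "u p \<le> 3/2" "\<delta> \<le> ang \<epsilon> p (u p)"
proof -
  have up: "u p \<le> 3/2" if "p \<ge> 0" for p
    by (rule barrier_upper[where u' = "\<lambda>p. slope p (u p)"]) (use that u u0 slope_trap in auto)
  have "- u p \<le> - (1/2)" if "p \<ge> 0" for p
    by (rule barrier_upper[where u' = "\<lambda>p. - slope p (u p)" and u = "\<lambda>p. - u p"])
       (use that u u0 slope_trap in \<open>auto intro!: derivative_eq_intros\<close>)
  hence lo: "1/2 \<le> u p" if "p \<ge> 0" for p using that by force
  show "1/2 \<le> u p" "u p \<le> 3/2" using up lo \<open>p \<ge> 0\<close> by auto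
  have "- ang \<epsilon> p (u p) \<le> - \<delta>"
  proof (rule barrier_upper[where u' = "\<lambda>p. - (slope p (u p) * (1 + \<epsilon> * sg p)
      + \<epsilon> * (1 - 2 * (sin p)\<^sup>2) * (u p - (1 - sg p) + sg p))" and u = "\<lambda>p. - ang \<epsilon> p (u p)"])
    \<comment> \<open>At phase 0 \<open>sg\<close> vanishes and \<open>ang\<close> equals
      \<open>u 0\<close>, so every start in the strip lies in the trapping region.\<close>
    show "- ang \<epsilon> 0 (u 0) \<le> - \<delta>" using u0 delta by (simp add: ang_def sg_def)
    show "((\<lambda>p. - ang \<epsilon> p (u p)) has_real_derivative
        - (slope t (u t) * (1 + \<epsilon> * sg t) + \<epsilon> * (1 - 2 * (sin t)\<^sup>2) * (u t - (1 - sg t) + sg t))) (at t)"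
      for t unfolding ang_def
      by (rule derivative_eq_intros u DERIV_sg refl | simp add: algebra_simps)+
    show "- (slope t (u t) * (1 + \<epsilon> * sg t) + \<epsilon> * (1 - 2 * (sin t)\<^sup>2) * (u t - (1 - sg t) + sg t)) \<le> 0"
      if "0 \<le> t" "- \<delta> < - ang \<epsilon> t (u t)" for t
      using ang_derivative_nonneg[OF lo up, OF that(1) that(1)] that(2) by force
  qed (use \<open>p \<ge> 0\<close> in auto)
  thus "\<delta> \<le> ang \<epsilon> p (u p)" by simp
qed

section \<open>The Poincare map and its fixed point\<close>

lemma periodic_radial_profile:
  obtains Z where "\<And>p. 1/2 \<le> Z p" "\<And>p. Z p \<le> 3/2" "\<And>p. \<delta> \<le> ang \<epsilon> p (Z p)"
    "\<And>p. Z (p + pi) = Z p"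
    "\<And>p. (Z has_real_derivative
       - 2 * \<epsilon> * (sin p)\<^sup>2 * Z p * (Z p - (1 - sg p)) / ang \<epsilon> p (Z p)) (at p)"
proof -
  obtain L where L: "L > 0" "\<And>p z w. \<bar>slope p z - slope p w\<bar> \<le> L * \<bar>z - w\<bar>"
    using slope_lipschitz by metis
  have "\<exists>u. u 0 = a \<and> (\<forall>p. (u has_real_derivative slope p (u p)) (at p))" for a
    using picard_global[OF slope_continuous, of L "3 * \<epsilon> / \<delta>" a] L slope_bound
    unfolding has_real_derivative_iff_has_vector_derivative by (auto simp: real_norm_def)
  then obtain u where u0: "\<And>a. u a 0 = a"
    and u: "\<And>a p. (u a has_real_derivative slope p (u a p)) (at p)" by metis
  have dist: "\<bar>v q - w q\<bar> \<le> exp (L * (q - p)) * \<bar>v p - w p\<bar>"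
    "\<bar>v p - w p\<bar> \<le> exp (L * (q - p)) * \<bar>v q - w q\<bar>"
    if "p \<le> q" "\<And>p. (v has_real_derivative slope p (v p)) (at p)"
      "\<And>p. (w has_real_derivative slope p (w p)) (at p)" for v w p q
  proof -
    have *: "((\<lambda>p. v p - w p) has_vector_derivative slope t (v t) - slope t (w t)) (at t)" for t
      unfolding has_real_derivative_iff_has_vector_derivative[symmetric]
      by (intro derivative_intros that)
    show "\<bar>v q - w q\<bar> \<le> exp (L * (q - p)) * \<bar>v p - w p\<bar>"
      "\<bar>v p - w p\<bar> \<le> exp (L * (q - p)) * \<bar>v q - w q\<bar>"
      using gronwall_norm[OF that(1) *, of L] L(2) by auto
  qed
  \<comment> \<open>This is the Poincare map over \<open>pi\<close>. Half a turn suffices because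
    the planar system is symmetric under reflection in the origin.\<close>
  have "continuous_on {1/2..3/2} (\<lambda>a. u a pi)"
  proof (rule lipschitz_on_continuous_on)
    show "(exp (L * pi))-lipschitz_on {1/2..3/2} (\<lambda>a. u a pi)"
      by (rule lipschitz_onI) (use dist(1)[OF pi_ge_zero u u] u0 in \<open>auto simp: dist_real_def\<close>)
  qed
  moreover have "(\<lambda>a. u a pi) \<in> {1/2..3/2} \<rightarrow> {1/2..3/2}"
    using slope_solution_trapped[OF u] u0 pi_ge_zero by auto
  ultimately obtain a where a: "a \<in> {1/2..3/2}" "u a pi = a"
    using brouwer[of "{1/2..3/2::real}" "\<lambda>a. u a pi"] by auto
  define Z where "Z = u a"
  have Z: "(Z has_real_derivative slope p (Z p)) (at p)" for p by (simp add: Z_def u)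
  have "((\<lambda>p. Z (p + pi)) has_real_derivative slope p (Z (p + pi))) (at p)" for p
    using Z[of "p + pi"] unfolding slope_periodic DERIV_shift .
  \<comment> \<open>The shifted solution solves the same equation and agrees with \<open>Z\<close>
    at 0, hence everywhere, by the Gronwall bounds in both directions.\<close>
  hence per: "Z (p + pi) = Z p" for p
    using dist[of 0 p "\<lambda>p. Z (p + pi)" Z] dist[of p 0 "\<lambda>p. Z (p + pi)" Z] Z a u0
    by (cases "p \<ge> 0") (auto simp: Z_def)
  \<comment> \<open>Trapping holds for nonnegative phases only; periodicity carries its bounds to
    all phases.\<close>
  have shift: "\<exists>n::nat. 0 \<le> p + real n * pi" for p
    using reals_Archimedean3[OF pi_gt_zero] by (metis diff_gt_0_iff_gt diff_minus_eq_add add.commute less_imp_le)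
  have pern: "Z (p + real n * pi) = Z p \<and> ang \<epsilon> (p + real n * pi) z = ang \<epsilon> p z" for p n z
  proof (induction n)
    case (Suc n)
    have "p + real (Suc n) * pi = (p + real n * pi) + pi" by (simp add: algebra_simps)
    thus ?case using Suc per[of "p + real n * pi"] unfolding ang_def by (metis sg_add_pi)
  qed simp
  have bounds: "1/2 \<le> Z p \<and> Z p \<le> 3/2 \<and> \<delta> \<le> ang \<epsilon> p (Z p)" for p
  proof -
    obtain n :: nat where "0 \<le> p + real n * pi" using shift by blast
    with slope_solution_trapped[OF Z _ _ this] a u0 show ?thesis
      by (simp add: pern Z_def[symmetric]) (simp add: Z_def)
  qed
  show thesis
  proof (rule that[of Z])
    \<comment> \<open>In the trapping region \<open>clip\<close> and \<open>max\<close> change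
      nothing, so the modified slope is the true one.\<close>
    show "(Z has_real_derivative
       - 2 * \<epsilon> * (sin p)\<^sup>2 * Z p * (Z p - (1 - sg p)) / ang \<epsilon> p (Z p)) (at p)" for p
      using Z[of p] bounds[of p] by (simp add: slope_def clip max_absorb2)
  qed (use bounds per in auto)
qed

end

section \<open>Polar coordinates\<close>

lemma planar_field_lipschitz:
  assumes "\<epsilon> > 0"
  shows "\<exists>L. L-lipschitz_on (cball 0 R) (planar_field \<epsilon>)"
proof (rule exI, rule lipschitz_onI)
  fix v w :: "real \<times> real" assume v: "v \<in> cball 0 R" and w: "w \<in> cball 0 R"
  obtain x y x' y' where xy: "v = (x, y)" "w = (x', y')" by (metis surj_pair)
  have b: "\<bar>x\<bar> \<le> R" "\<bar>y\<bar> \<le> R" "\<bar>x'\<bar> \<le> R" "\<bar>y'\<bar> \<le> R"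
    using v w norm_fst_le[of x y] norm_snd_le[of y x] norm_fst_le[of x' y'] norm_snd_le[of y' x'] xy
    by auto
  have d: "\<bar>x - x'\<bar> \<le> norm (v - w)" "\<bar>y - y'\<bar> \<le> norm (v - w)"
    using norm_fst_le[of "x - x'" "y - y'"] norm_snd_le[of "y - y'" "x - x'"] xy by auto
  have prod: "\<bar>p * q\<bar> \<le> R * R" if "\<bar>p\<bar> \<le> R" "\<bar>q\<bar> \<le> R" for p q
    unfolding abs_mult using that by (intro mult_mono) auto
  have c1: "\<bar>y * x + y * x' + y * y\<bar> \<le> 3 * (R * R)"
    using prod[OF b(2,1)] prod[OF b(2,3)] prod[OF b(2,2)] unfolding abs_le_iff by linarith
  have c2: "\<bar>x' * x' + x' * y + x' * y' + y * y + y * y' + y' * y' - 1\<bar> \<le> 6 * (R * R) + 1"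
    using prod[OF b(3,3)] prod[OF b(3,2)] prod[OF b(3,4)] prod[OF b(2,2)] prod[OF b(2,4)]
      prod[OF b(4,4)] unfolding abs_le_iff by linarith
  have RR: "0 \<le> R * R" by simp
  \<comment> \<open>The first coordinate is changed while \<open>y\<close> is fixed, then the second
    while \<open>x'\<close> is fixed; each cofactor is bounded on the ball.\<close>
  have "y * (x\<^sup>2 + x * y + y\<^sup>2 - 1) - y' * (x'\<^sup>2 + x' * y' + y'\<^sup>2 - 1)
      = (x - x') * (y * x + y * x' + y * y)
        + (y - y') * (x' * x' + x' * y + x' * y' + y * y + y * y' + y' * y' - 1)"
    by (simp add: algebra_simps power2_eq_square)
  also have "\<bar>\<dots>\<bar> \<le> norm (v - w) * (3 * (R * R)) + norm (v - w) * (6 * (R * R) + 1)"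
    by (rule order_trans[OF abs_triangle_ineq], unfold abs_mult)
       (intro add_mono mult_mono d c1 c2; simp)
  finally have g: "\<bar>y * (x\<^sup>2 + x * y + y\<^sup>2 - 1) - y' * (x'\<^sup>2 + x' * y' + y'\<^sup>2 - 1)\<bar>
      \<le> (9 * (R * R) + 1) * norm (v - w)" by (simp add: algebra_simps)
  have "planar_field \<epsilon> v - planar_field \<epsilon> w = (y - y', - (x - x')
      - \<epsilon> * (y * (x\<^sup>2 + x * y + y\<^sup>2 - 1) - y' * (x'\<^sup>2 + x' * y' + y'\<^sup>2 - 1)))"
    by (simp add: planar_field_def xy algebra_simps)
  also have "norm \<dots> \<le> \<bar>y - y'\<bar> + \<bar>- (x - x')
      - \<epsilon> * (y * (x\<^sup>2 + x * y + y\<^sup>2 - 1) - y' * (x'\<^sup>2 + x' * y' + y'\<^sup>2 - 1))\<bar>"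
    using norm_Pair_le by (metis real_norm_def)
  also have "\<dots> \<le> norm (v - w) + (norm (v - w) + \<epsilon> * ((9 * (R * R) + 1) * norm (v - w)))"
  proof (intro add_mono d order_trans[OF abs_triangle_ineq4])
    show "\<bar>- (x - x')\<bar> \<le> norm (v - w)" using d by simp
    show "\<bar>\<epsilon> * (y * (x\<^sup>2 + x * y + y\<^sup>2 - 1) - y' * (x'\<^sup>2 + x' * y' + y'\<^sup>2 - 1))\<bar>
        \<le> \<epsilon> * ((9 * (R * R) + 1) * norm (v - w))"
      unfolding abs_mult[of \<epsilon>] using g assms by (intro mult_mono) auto
  qed
  also have "\<dots> = (2 + \<epsilon> * (9 * (R * R) + 1)) * norm (v - w)" by (simp add: algebra_simps)
  finally show "dist (planar_field \<epsilon> v) (planar_field \<epsilon> w) \<le> (2 + \<epsilon> * (9 * (R * R) + 1)) * dist v w"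
    by (simp add: dist_norm)
qed (use assms in simp)

section \<open>Passage between Cartesian and polar solutions\<close>

lemma planar_solution_components:
  assumes "is_solution (planar_field \<epsilon>) I \<gamma>" "t \<in> I"
  shows "((\<lambda>t. fst (\<gamma> t)) has_real_derivative snd (\<gamma> t)) (at t)"
    "((\<lambda>t. snd (\<gamma> t)) has_real_derivative - fst (\<gamma> t)
       - \<epsilon> * snd (\<gamma> t) * ((fst (\<gamma> t))\<^sup>2 + fst (\<gamma> t) * snd (\<gamma> t) + (snd (\<gamma> t))\<^sup>2 - 1)) (at t)"
proof -
  have d: "(\<gamma> has_vector_derivative planar_field \<epsilon> (\<gamma> t)) (at t)"
    using assms by (simp add: is_solution_def)
  from bounded_linear.has_vector_derivative[OF bounded_linear_fst d]
    bounded_linear.has_vector_derivative[OF bounded_linear_snd d]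
  show "((\<lambda>t. fst (\<gamma> t)) has_real_derivative snd (\<gamma> t)) (at t)"
    "((\<lambda>t. snd (\<gamma> t)) has_real_derivative - fst (\<gamma> t)
       - \<epsilon> * snd (\<gamma> t) * ((fst (\<gamma> t))\<^sup>2 + fst (\<gamma> t) * snd (\<gamma> t) + (snd (\<gamma> t))\<^sup>2 - 1)) (at t)"
    unfolding has_real_derivative_iff_has_vector_derivative
    by (auto simp: planar_field_def case_prod_beta)
qed

text \<open>The minus sign makes the phase increase along clockwise motion. The inverse square of
  the radius is chosen because its equation is affine in \<open>z\<close> for given phase.\<close>

definition polar :: "real \<Rightarrow> real \<Rightarrow> real \<times> real" where
  "polar p z = (cos p / sqrt z, - sin p / sqrt z)"

lemma polar_solution:
  assumes "open I" "is_interval I" "I \<noteq> {}" and pos: "\<And>t. t \<in> I \<Longrightarrow> z t > 0"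
    and p: "\<And>t. t \<in> I \<Longrightarrow> (p has_real_derivative ang \<epsilon> (p t) (z t) / z t) (at t)"
    and z: "\<And>t. t \<in> I \<Longrightarrow>
      (z has_real_derivative - 2 * \<epsilon> * (sin (p t))\<^sup>2 * (z t - (1 - sg (p t)))) (at t)"
  shows "is_solution (planar_field \<epsilon>) I (\<lambda>t. polar (p t) (z t))"
  unfolding is_solution_def
proof (intro conjI ballI)
  fix t assume t: "t \<in> I"
  define s c r where "s = sin (p t)" and "c = cos (p t)" and "r = sqrt (z t)"
  \<comment> \<open>\<open>m\<close> is the derivative of the radius \<open>1 / sqrt (z t)\<close>,
    and \<open>k\<close> that of the phase.\<close>
  define m where "m = - (- 2 * \<epsilon> * s\<^sup>2 * (z t - (1 - s * c))) / (2 * r ^ 3)"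
  define k where "k = ang \<epsilon> (p t) (z t) / z t"
  have r: "r > 0" "z t = r\<^sup>2" using pos[OF t] by (auto simp: r_def)
  have sc: "s\<^sup>2 + c\<^sup>2 = 1" by (simp add: s_def c_def)
  have ri: "((\<lambda>t. 1 / sqrt (z t)) has_real_derivative m) (at t)"
  proof -
    have "((\<lambda>t. 1 / sqrt (z t)) has_real_derivative
        - (- 2 * \<epsilon> * (sin (p t))\<^sup>2 * (z t - (1 - sg (p t))) * (inverse (sqrt (z t)) / 2)) / (sqrt (z t))\<^sup>2) (at t)"
      using pos[OF t] by (auto intro!: derivative_eq_intros z t simp: power2_eq_square)
    moreover have "- (- 2 * \<epsilon> * (sin (p t))\<^sup>2 * (z t - (1 - sg (p t))) * (inverse (sqrt (z t)) / 2)) / (sqrt (z t))\<^sup>2 = m"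
      using r(1) unfolding m_def s_def[symmetric] c_def[symmetric] r_def[symmetric] sg_def
      by (simp add: field_simps power2_eq_square power3_eq_cube)
    ultimately show ?thesis by simp
  qed
  have k: "k = 1 + \<epsilon> * s * c * (r\<^sup>2 - (1 - s * c)) / r\<^sup>2"
    using r unfolding k_def ang_def sg_def s_def[symmetric] c_def[symmetric] r(2)
    by (simp add: field_simps)
  have x: "((\<lambda>t. cos (p t) * (1 / sqrt (z t))) has_real_derivative - s * k * (1 / r) + m * c) (at t)"
    by (rule derivative_eq_intros p[OF t] ri refl)+ (simp add: s_def c_def r_def k_def)
  have y: "((\<lambda>t. - sin (p t) * (1 / sqrt (z t))) has_real_derivative - (c * k * (1 / r)) - m * s) (at t)"
    by (rule derivative_eq_intros p[OF t] ri refl)+ (simp add: s_def c_def r_def k_def)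
  have "- s * k * (1 / r) + m * c = - s / r"
    unfolding k m_def r(2) using r(1) by (simp add: field_simps power2_eq_square power3_eq_cube)
  moreover have "- (c * k * (1 / r)) - m * s
      = - (c / r) - \<epsilon> * (- s / r) * ((c / r)\<^sup>2 + c / r * (- s / r) + (- s / r)\<^sup>2 - 1)"
  proof -
    have "(c / r)\<^sup>2 + c / r * (- s / r) + (- s / r)\<^sup>2 - 1 = (s\<^sup>2 + c\<^sup>2 - s * c - r\<^sup>2) / r\<^sup>2"
      using r(1) by (simp add: field_simps power2_eq_square)
    also have "\<dots> = - ((r\<^sup>2 - (1 - s * c)) / r\<^sup>2)" unfolding sc minus_divide_left by (simp add: algebra_simps)
    finally have 1: "(c / r)\<^sup>2 + c / r * (- s / r) + (- s / r)\<^sup>2 - 1 = - ((r\<^sup>2 - (1 - s * c)) / r\<^sup>2)" .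
    \<comment> \<open>Both derivatives deviate from pure rotation by multiples of \<open>A\<close>;
      in the second component these combine through \<open>s\<^sup>2 + c\<^sup>2 = 1\<close> into
      the damping term.\<close>
    define A where "A = (r\<^sup>2 - (1 - s * c)) / r\<^sup>2"
    have "k = 1 + \<epsilon> * s * c * A" "m = \<epsilon> * s\<^sup>2 * A / r"
      using r(1) by (simp_all add: k A_def m_def r(2) field_simps power2_eq_square power3_eq_cube)
    hence "- (c * k * (1 / r)) - m * s = - (c / r) - \<epsilon> * s * A * (s\<^sup>2 + c\<^sup>2) / r"
      using r(1) by (simp add: field_simps power2_eq_square)
    thus ?thesis unfolding 1 sc A_def by simp
  qed
  ultimately have "((\<lambda>t. (cos (p t) * (1 / sqrt (z t)), - sin (p t) * (1 / sqrt (z t)))) has_vector_derivative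
      planar_field \<epsilon> (c / r, - s / r)) (at t)"
    using x y unfolding planar_field_def has_real_derivative_iff_has_vector_derivative
    by (auto intro!: has_vector_derivative_Pair)
  thus "((\<lambda>t. polar (p t) (z t)) has_vector_derivative planar_field \<epsilon> (polar (p t) (z t))) (at t)"
    by (simp add: polar_def s_def c_def r_def)
qed (use assms in auto)

text \<open>The phase is obtained by integrating the angular speed computed from \<open>x\<close>
  and \<open>y\<close>, which avoids choosing branches of the argument. That it really is the phase
  is checked afterwards, by a conservation argument.\<close>

lemma polar_lift:
  assumes sol: "is_solution (planar_field \<epsilon>) I \<gamma>" and t0: "t0 \<in> I"
    and nz: "\<And>t. t \<in> I \<Longrightarrow> \<gamma> t \<noteq> 0"
  obtains p z where "\<And>t. t \<in> I \<Longrightarrow> z t > 0" "\<And>t. t \<in> I \<Longrightarrow> \<gamma> t = polar (p t) (z t)"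
    "\<And>t. t \<in> I \<Longrightarrow> (p has_real_derivative ang \<epsilon> (p t) (z t) / z t) (at t)"
    "\<And>t. t \<in> I \<Longrightarrow>
      (z has_real_derivative - 2 * \<epsilon> * (sin (p t))\<^sup>2 * (z t - (1 - sg (p t)))) (at t)"
proof -
  have I: "open I" "is_interval I" using sol by (auto simp: is_solution_def)
  define x y where "x t = fst (\<gamma> t)" and "y t = snd (\<gamma> t)" for t
  define Q where "Q t = (x t)\<^sup>2 + x t * y t + (y t)\<^sup>2 - 1" for t
  have dx: "(x has_real_derivative y t) (at t)"
    and dy: "(y has_real_derivative - x t - \<epsilon> * y t * Q t) (at t)" if "t \<in> I" for t
    using planar_solution_components[OF sol that] by (auto simp: x_def[abs_def] y_def[abs_def] Q_def)
  have pos: "(x t)\<^sup>2 + (y t)\<^sup>2 > 0" if "t \<in> I" for t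
    using nz[OF that] unfolding x_def y_def by (simp add: sum_power2_gt_zero_iff prod_eq_iff)
  define \<rho> where "\<rho> t = 1 / sqrt ((x t)\<^sup>2 + (y t)\<^sup>2)" for t
  have \<rho>: "\<rho> t > 0" "(\<rho> t)\<^sup>2 * ((x t)\<^sup>2 + (y t)\<^sup>2) = 1" if "t \<in> I" for t
    using pos[OF that] by (auto simp: \<rho>_def power_divide)
  have d\<rho>: "(\<rho> has_real_derivative \<epsilon> * (y t)\<^sup>2 * Q t * \<rho> t ^ 3) (at t)" if "t \<in> I" for t
  proof -
    let ?r = "sqrt ((x t)\<^sup>2 + (y t)\<^sup>2)"
    have "(\<rho> has_real_derivative - ((2 * x t * y t + 2 * y t * (- x t - \<epsilon> * y t * Q t))
        * (inverse ?r / 2)) / (?r)\<^sup>2) (at t)"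
      unfolding \<rho>_def[abs_def] using pos[OF that]
      by (auto intro!: derivative_eq_intros dx dy that simp: power2_eq_square)
    moreover have "- ((2 * x t * y t + 2 * y t * (- x t - \<epsilon> * y t * Q t)) * (inverse ?r / 2)) / (?r)\<^sup>2
        = \<epsilon> * (y t)\<^sup>2 * Q t * \<rho> t ^ 3"
    proof -
      have "?r \<noteq> 0" using pos[OF that] by (auto simp: sum_power2_gt_zero_iff)
      thus ?thesis unfolding \<rho>_def
        by (simp add: field_simps power2_eq_square power3_eq_cube del: real_sqrt_mult_self real_sqrt_eq_zero_cancel_iff)
    qed
    ultimately show ?thesis by simp
  qed
  define h where "h t = 1 + \<epsilon> * x t * y t * Q t * (\<rho> t)\<^sup>2" for t
  have "continuous_on I x" "continuous_on I y" "continuous_on I \<rho>"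
    using dx dy d\<rho> by (meson DERIV_isCont continuous_at_imp_continuous_on)+
  hence "continuous_on I h" unfolding h_def Q_def by (intro continuous_intros)
  from antiderivative_on_open_interval[OF I t0 this] obtain H
    where H: "H t0 = 0" "\<And>t. t \<in> I \<Longrightarrow> (H has_vector_derivative h t) (at t)" by blast
  have "(\<rho> t0 * x t0)\<^sup>2 + (- (\<rho> t0 * y t0))\<^sup>2 = 1"
    using \<rho>(2)[OF t0] by (simp add: power_mult_distrib algebra_simps)
  then obtain p0 where p0: "\<rho> t0 * x t0 = cos p0" "- (\<rho> t0 * y t0) = sin p0"
    using sincos_total_2pi_le by metis
  define p where "p t = p0 + H t" for t
  have dp: "(p has_real_derivative h t) (at t)" if "t \<in> I" for t
    unfolding p_def[abs_def] using H(2)[OF that]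
    by (auto simp: has_real_derivative_iff_has_vector_derivative intro!: derivative_eq_intros)
  \<comment> \<open>The components of the normalized solution in the frame that rotates with
    \<open>p\<close>. The polar representation amounts to \<open>C = 1\<close> and
    \<open>D = 0\<close>, which holds at \<open>t0\<close> by the choice of
    \<open>p0\<close>.\<close>
  define C D where "C t = \<rho> t * (x t * cos (p t) - y t * sin (p t))"
    and "D t = \<rho> t * (x t * sin (p t) + y t * cos (p t))" for t
  have dC: "(C has_real_derivative 0) (at t)" and dD: "(D has_real_derivative 0) (at t)"
    if t: "t \<in> I" for t
  proof -
    define X Y q r s c where "X = x t" and "Y = y t" and "q = Q t" and "r = \<rho> t"
      and "s = sin (p t)" and "c = cos (p t)"
    have r: "r\<^sup>2 * (X\<^sup>2 + Y\<^sup>2) = 1" using \<rho>(2)[OF t] by (simp add: r_def X_def Y_def)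
    have "(C has_real_derivative (\<epsilon> * Y\<^sup>2 * q * r ^ 3) * (X * c - Y * s)
        + r * (Y * c - X * s * h t - ((- X - \<epsilon> * Y * q) * s + Y * c * h t))) (at t)"
      unfolding C_def[abs_def]
      by (rule derivative_eq_intros dx dy d\<rho> dp t refl)+
         (simp add: X_def Y_def q_def r_def s_def c_def algebra_simps)
    \<comment> \<open>All terms cancel up to a multiple of
      \<open>1 - r\<^sup>2 * (X\<^sup>2 + Y\<^sup>2)\<close>, which is zero because \<rho> is the
      inverse radius.\<close>
    moreover have "(\<epsilon> * Y\<^sup>2 * q * r ^ 3) * (X * c - Y * s)
        + r * (Y * c - X * s * h t - ((- X - \<epsilon> * Y * q) * s + Y * c * h t))
        = r * \<epsilon> * Y * q * s * (1 - r\<^sup>2 * (X\<^sup>2 + Y\<^sup>2))"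
      unfolding h_def X_def[symmetric] Y_def[symmetric] q_def[symmetric] r_def[symmetric]
      by (simp add: algebra_simps power2_eq_square power3_eq_cube)
    ultimately show "(C has_real_derivative 0) (at t)" using r by simp
    have "(D has_real_derivative (\<epsilon> * Y\<^sup>2 * q * r ^ 3) * (X * s + Y * c)
        + r * (Y * s + X * c * h t + ((- X - \<epsilon> * Y * q) * c - Y * s * h t))) (at t)"
      unfolding D_def[abs_def]
      by (rule derivative_eq_intros dx dy d\<rho> dp t refl)+
         (simp add: X_def Y_def q_def r_def s_def c_def algebra_simps)
    moreover have "(\<epsilon> * Y\<^sup>2 * q * r ^ 3) * (X * s + Y * c)
        + r * (Y * s + X * c * h t + ((- X - \<epsilon> * Y * q) * c - Y * s * h t))
        = - (r * \<epsilon> * Y * q * c * (1 - r\<^sup>2 * (X\<^sup>2 + Y\<^sup>2)))"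
      unfolding h_def X_def[symmetric] Y_def[symmetric] q_def[symmetric] r_def[symmetric]
      by (simp add: algebra_simps power2_eq_square power3_eq_cube)
    ultimately show "(D has_real_derivative 0) (at t)" using r by simp
  qed
  have const: "F t = F t0" if "\<And>t. t \<in> I \<Longrightarrow> (F has_real_derivative 0) (at t)" "t \<in> I" for F t
    using has_field_derivative_zero_constant[of I F] that t0 I
    by (metis has_field_derivative_at_within is_interval_convex_1)
  have C1: "C t = 1" and D0: "D t = 0" if "t \<in> I" for t
  proof -
    have "C t0 = (\<rho> t0 * x t0) * cos p0 + (- (\<rho> t0 * y t0)) * sin p0"
      using H(1) by (simp add: C_def p_def algebra_simps)
    also have "\<dots> = cos p0 * cos p0 + sin p0 * sin p0" unfolding p0 ..
    finally show "C t = 1" using const[OF dC that] by (simp add: power2_eq_square[symmetric])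
    have "D t0 = (\<rho> t0 * x t0) * sin p0 - (- (\<rho> t0 * y t0)) * cos p0"
      using H(1) by (simp add: D_def p_def algebra_simps)
    also have "\<dots> = cos p0 * sin p0 - sin p0 * cos p0" unfolding p0 ..
    finally show "D t = 0" using const[OF dD that] by simp
  qed
  have xc: "\<rho> t * x t = cos (p t)" and ys: "\<rho> t * y t = - sin (p t)" if "t \<in> I" for t
  proof -
    have sc: "(sin (p t))\<^sup>2 + (cos (p t))\<^sup>2 = 1" by simp
    have "\<rho> t * x t * ((sin (p t))\<^sup>2 + (cos (p t))\<^sup>2) = C t * cos (p t) + D t * sin (p t)"
      unfolding C_def D_def by algebra
    thus "\<rho> t * x t = cos (p t)" using C1[OF that] D0[OF that] sc by simp
    have "\<rho> t * y t * ((sin (p t))\<^sup>2 + (cos (p t))\<^sup>2) = - (C t * sin (p t)) + D t * cos (p t)"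
      unfolding C_def D_def by algebra
    thus "\<rho> t * y t = - sin (p t)" using C1[OF that] D0[OF that] sc by simp
  qed
  define z where "z t = (\<rho> t)\<^sup>2" for t
  have Qz: "(\<rho> t)\<^sup>2 * Q t = 1 - sg (p t) - z t" if "t \<in> I" for t
  proof -
    have "(\<rho> t)\<^sup>2 * Q t = (\<rho> t)\<^sup>2 * ((x t)\<^sup>2 + (y t)\<^sup>2) + (\<rho> t * x t) * (\<rho> t * y t) - z t"
      by (simp add: Q_def z_def algebra_simps power2_eq_square)
    thus ?thesis unfolding \<rho>(2)[OF that] xc[OF that] ys[OF that] sg_def by (simp add: mult.commute)
  qed
  show thesis
  proof (rule that[of z p])
    fix t assume t: "t \<in> I"
    show zp: "z t > 0" using \<rho>[OF t] by (simp add: z_def)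
    have "x t = cos (p t) / \<rho> t" "y t = - sin (p t) / \<rho> t"
      unfolding xc[OF t, symmetric] ys[OF t, symmetric] using \<rho>(1)[OF t] by simp_all
    moreover have "sqrt (z t) = \<rho> t" using \<rho>[OF t] by (simp add: z_def)
    ultimately show "\<gamma> t = polar (p t) (z t)"
      by (simp add: polar_def prod_eq_iff x_def y_def)
    have "h t = 1 + \<epsilon> * ((\<rho> t * x t) * (\<rho> t * y t)) * ((\<rho> t)\<^sup>2 * Q t) / z t"
      using zp by (simp add: h_def z_def power2_eq_square)
    also have "\<dots> = ang \<epsilon> (p t) (z t) / z t"
      unfolding Qz[OF t] xc[OF t] ys[OF t] ang_def using zp
      by (simp add: field_simps sg_def)
    finally show "(p has_real_derivative ang \<epsilon> (p t) (z t) / z t) (at t)" using dp[OF t] by simp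
    have "(z has_real_derivative 2 * (\<epsilon> * (y t)\<^sup>2 * Q t * \<rho> t ^ 3) * \<rho> t) (at t)"
      unfolding z_def[abs_def] by (auto intro!: derivative_eq_intros d\<rho>[OF t])
    moreover have "2 * (\<epsilon> * (y t)\<^sup>2 * Q t * \<rho> t ^ 3) * \<rho> t = 2 * \<epsilon> * (\<rho> t * y t)\<^sup>2 * ((\<rho> t)\<^sup>2 * Q t)"
      by (simp add: power2_eq_square power3_eq_cube)
    moreover have "\<dots> = - 2 * \<epsilon> * (sin (p t))\<^sup>2 * (z t - (1 - sg (p t)))"
      unfolding Qz[OF t] ys[OF t] by (simp add: algebra_simps)
    ultimately show "(z has_real_derivative - 2 * \<epsilon> * (sin (p t))\<^sup>2 * (z t - (1 - sg (p t)))) (at t)"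
      by simp
  qed
qed

section \<open>The limit cycle and its attraction\<close>

text \<open>Growth at least linear gives injectivity and, by the intermediate value theorem,
  surjectivity. It serves for time as a function of phase on the cycle, and for phase as a function
  of time on a periodic solution.\<close>

lemma derivative_bounded_below_imp_bij:
  fixes f f' :: "real \<Rightarrow> real"
  assumes "m > 0" and der: "\<And>t. (f has_real_derivative f' t) (at t)" and ge: "\<And>t. m \<le> f' t"
  shows "bij f"
proof -
  have mono: "m * (t - s) \<le> f t - f s" if "s \<le> t" for s t
  proof -
    have "f s - m * s \<le> f t - m * t"
    proof (rule DERIV_nonneg_imp_nondecreasing[OF that])
      show "\<exists>y. ((\<lambda>t. f t - m * t) has_real_derivative y) (at r) \<and> 0 \<le> y" for r
        using ge[of r] by (intro exI[of _ "f' r - m"]) (auto intro!: derivative_eq_intros der)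
    qed
    thus ?thesis by (simp add: algebra_simps)
  qed
  have "strict_mono f"
  proof (rule strict_monoI)
    fix s t :: real assume "s < t"
    thus "f s < f t" using mono[of s t] mult_pos_pos[OF \<open>m > 0\<close>, of "t - s"] by auto
  qed
  hence "inj f" by (rule strict_mono_imp_inj_on)
  moreover have "surj f"
    unfolding surj_def
  proof
    fix y
    define r where "r = \<bar>y - f 0\<bar> / m"
    have r: "0 \<le> r" "m * r = \<bar>y - f 0\<bar>" using \<open>m > 0\<close> by (auto simp: r_def)
    have "f (- r) \<le> y" "y \<le> f r" using mono[of 0 r] mono[of "- r" 0] r by auto
    moreover have "\<forall>t. - r \<le> t \<and> t \<le> r \<longrightarrow> isCont f t" using der DERIV_isCont by blast
    ultimately show "\<exists>t. y = f t" using IVT[of f "- r" y r] r by auto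
  qed
  ultimately show ?thesis by (simp add: bij_def)
qed

lemma polar_nonzero: "z > 0 \<Longrightarrow> polar p z \<noteq> 0"
  using sin_zero_abs_cos_one[of p] by (auto simp: polar_def prod_eq_iff)

lemma dist_polar: "dist (polar p z) (polar p w) = \<bar>1 / sqrt z - 1 / sqrt w\<bar>"
proof -
  define d where "d = 1 / sqrt z - 1 / sqrt w"
  have "polar p z - polar p w = (cos p * d, - (sin p * d))"
    by (simp add: polar_def d_def algebra_simps)
  moreover have "(cos p * d)\<^sup>2 + (- (sin p * d))\<^sup>2 = ((sin p)\<^sup>2 + (cos p)\<^sup>2) * d\<^sup>2"
    by algebra
  ultimately show ?thesis by (simp add: dist_norm norm_Pair d_def)
qed

lemma norm_polar: "z > 0 \<Longrightarrow> norm (polar p z) = 1 / sqrt z"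
  \<comment> \<open>Division by zero yields zero, so \<open>polar p 0\<close> is the origin.\<close>
  using dist_polar[of p z 0] by (simp add: polar_def dist_norm zero_prod_def)

lemma polar_eq_iff:
  assumes "z > 0" "w > 0"
  shows "polar p z = polar q w \<longleftrightarrow> z = w \<and> (\<exists>n::int. p = q + 2 * pi * n)"
proof
  assume eq: "polar p z = polar q w"
  hence "1 / sqrt z = 1 / sqrt w" using norm_polar assms by metis
  hence "z = w" using assms by (simp add: field_simps)
  moreover from this eq have "cos p = cos q" "sin p = sin q" using assms by (auto simp: polar_def)
  ultimately show "z = w \<and> (\<exists>n::int. p = q + 2 * pi * n)" using sin_cos_eq_iff[of p q] by auto
next
  assume "z = w \<and> (\<exists>n::int. p = q + 2 * pi * n)"
  thus "polar p z = polar q w" using sin_cos_eq_iff[of p q] by (auto simp: polar_def)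
qed

section \<open>The cycle of a periodic profile\<close>

locale radial_profile = planar_parameter +
  fixes Z :: "real \<Rightarrow> real"
  assumes Z_ge: "1/2 \<le> Z p" and Z_le: "Z p \<le> 3/2" and ang_Z: "\<delta> \<le> ang \<epsilon> p (Z p)"
    and Z_periodic: "Z (p + pi) = Z p"
    and DERIV_Z: "(Z has_real_derivative
      - 2 * \<epsilon> * (sin p)\<^sup>2 * Z p * (Z p - (1 - sg p)) / ang \<epsilon> p (Z p)) (at p)"
begin

definition cyc :: "(real \<times> real) set" where
  "cyc = range (\<lambda>p. polar p (Z p))"

lemma Z_pos: "Z p > 0"
  using Z_ge[of p] by linarith

lemma ang_Z_pos: "ang \<epsilon> p (Z p) > 0"
  using ang_Z[of p] delta by linarith

lemma ang_Z_le: "ang \<epsilon> p (Z p) \<le> 3/2 + \<epsilon>"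
proof -
  have "\<bar>\<epsilon> * sg p * (Z p - (1 - sg p))\<bar> \<le> \<epsilon> * 1 * 1"
    unfolding abs_mult using eps sg_bounds[of p] Z_ge[of p] Z_le[of p] by (intro mult_mono) auto
  thus ?thesis using Z_le[of p] unfolding ang_def by linarith
qed

lemma Z_shift: "Z (p + 2 * pi * of_int n) = Z p"
proof -
  have nat: "Z (p + real k * pi) = Z p" for p k
  proof (induction k)
    case (Suc k)
    have "p + real (Suc k) * pi = (p + real k * pi) + pi" by (simp add: algebra_simps)
    thus ?case using Suc Z_periodic by metis
  qed simp
  show ?thesis
  proof (cases "n \<ge> 0")
    case True
    thus ?thesis using nat[of p "nat (2 * n)"] by (simp add: mult.commute mult.left_commute)
  next
    case False
    thus ?thesis using nat[of "p + 2 * pi * of_int n" "nat (- 2 * n)"]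
      by (simp add: mult.commute mult.left_commute)
  qed
qed

lemma polar_Z_shift: "polar (p + 2 * pi * of_int n) (Z (p + 2 * pi * of_int n)) = polar p (Z p)"
  using polar_eq_iff[OF Z_pos Z_pos] Z_shift by blast

text \<open>One full turn of phases already covers the cycle, so it is a compact image. Closedness
  lets zero distance imply membership in the uniqueness argument.\<close>

lemma closed_cyc: "closed cyc"
proof -
  have "cyc = (\<lambda>p. polar p (Z p)) ` {-pi..pi}"
  proof -
    have "polar p (Z p) \<in> (\<lambda>p. polar p (Z p)) ` {-pi..pi}" for p
    proof -
      obtain q where q: "- pi < q" "q \<le> pi" "sin q = sin p" "cos q = cos p"
        using sincos_principal_value by blast
      then obtain n :: int where "q = p + 2 * pi * n" using sin_cos_eq_iff by blast
      hence "polar p (Z p) = polar q (Z q)" using polar_Z_shift by simp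
      thus ?thesis using q by (intro image_eqI[of _ _ q]) auto
    qed
    thus ?thesis by (auto simp: cyc_def)
  qed
  moreover have "continuous_on {-pi..pi} (\<lambda>p. polar p (Z p))"
  proof -
    have "continuous_on {-pi..pi} Z"
      using DERIV_Z by (meson DERIV_isCont continuous_at_imp_continuous_on)
    moreover have "sqrt (Z p) \<noteq> 0" for p using Z_pos[of p] by simp
    ultimately show ?thesis unfolding polar_def by (intro continuous_intros) auto
  qed
  ultimately show ?thesis
    by (metis compact_Icc compact_continuous_image compact_imp_closed)
qed

text \<open>The cycle is known as a curve over the phase. Integrating the reciprocal of the angular
  speed gives time as a function of phase, and its inverse parametrizes the cycle by time.\<close>

lemma limit_cycle_cyc: "limit_cycle (planar_field \<epsilon>) cyc"
proof -
  define k where "k p = Z p / ang \<epsilon> p (Z p)" for p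
  have k_shift: "k (p + 2 * pi) = k p" for p
    using Z_shift[of p 1] by (simp add: k_def ang_def sg_def)
  have k_ge: "k p \<ge> (1/2) / (3/2 + \<epsilon>)" for p
    unfolding k_def using Z_ge ang_Z_le ang_Z_pos eps by (intro frac_le) (auto intro: less_imp_le Z_pos)
  have k0: "(1/2) / (3/2 + \<epsilon>) > 0" using eps by simp
  have k_pos: "k p > 0" for p using k_ge[of p] k0 by linarith
  have Zcont: "continuous_on UNIV Z"
    using DERIV_Z by (meson DERIV_isCont continuous_at_imp_continuous_on)
  have "continuous_on UNIV k"
    unfolding k_def ang_def sg_def
    by (intro continuous_intros Zcont) (use ang_Z_pos in \<open>auto simp: ang_def sg_def dest: less_imp_neq[symmetric]\<close>)
  from antiderivative_on_open_interval[OF open_UNIV is_interval_univ UNIV_I this, of 0]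
  obtain \<tau> where \<tau>: "\<And>p. (\<tau> has_real_derivative k p) (at p)"
    unfolding has_real_derivative_iff_has_vector_derivative by auto
  have bij: "bij \<tau>" by (rule derivative_bounded_below_imp_bij[OF k0 \<tau> k_ge])
  define \<psi> where "\<psi> = inv \<tau>"
  have \<psi>\<tau>: "\<psi> (\<tau> p) = p" and \<tau>\<psi>: "\<tau> (\<psi> t) = t" for p t
    using bij by (simp_all add: \<psi>_def bij_is_inj bij_is_surj surj_f_inv_f)
  have d\<psi>: "(\<psi> has_real_derivative inverse (k (\<psi> t))) (at t)" for t
  proof -
    have "(\<psi> has_derivative (*) (inverse (k (\<psi> t)))) (at t)"
    proof (rule has_derivative_inverse_strong_x[where f = \<tau> and S = UNIV])
      show "continuous_on UNIV \<tau>" using \<tau> by (meson DERIV_isCont continuous_at_imp_continuous_on)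
      show "(\<tau> has_derivative (*) (k (\<psi> t))) (at (\<psi> t))"
        using \<tau> by (simp add: has_field_derivative_def)
    qed (use k_pos[of "\<psi> t"] \<psi>\<tau> \<tau>\<psi> in \<open>auto simp: fun_eq_iff\<close>)
    thus ?thesis by (simp add: has_field_derivative_def)
  qed
  \<comment> \<open>The time of one full turn; as the integrand has period \<open>2 * pi\<close>,
    every turn takes equally long.\<close>
  define T where "T = \<tau> (2 * pi) - \<tau> 0"
  have "\<tau> 0 < \<tau> (2 * pi)"
    by (rule DERIV_pos_imp_increasing) (use \<tau> k_pos in auto)
  hence T: "T > 0" by (simp add: T_def)
  have \<tau>_shift: "\<tau> (p + 2 * pi) = \<tau> p + T" for p
  proof -
    have "((\<lambda>p. \<tau> (p + 2 * pi) - \<tau> p) has_real_derivative 0) (at p)" for p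
    proof -
      have "((\<lambda>p. \<tau> (p + 2 * pi)) has_real_derivative k p) (at p)"
        using \<tau>[of "p + 2 * pi"] unfolding DERIV_shift k_shift .
      from DERIV_diff[OF this \<tau>[of p]] show ?thesis by simp
    qed
    hence "\<tau> (p + 2 * pi) - \<tau> p = \<tau> (0 + 2 * pi) - \<tau> 0" by (intro DERIV_isconst_all) auto
    thus ?thesis by (simp add: T_def)
  qed
  have \<psi>_shift: "\<psi> (t + T) = \<psi> t + 2 * pi" for t
    using \<tau>_shift[of "\<psi> t"] \<psi>\<tau> \<tau>\<psi> by metis
  define \<gamma> where "\<gamma> t = polar (\<psi> t) (Z (\<psi> t))" for t
  have inv_k: "inverse (k p) = ang \<epsilon> p (Z p) / Z p" for p by (simp add: k_def)
  have "is_solution (planar_field \<epsilon>) UNIV (\<lambda>t. polar (\<psi> t) ((Z \<circ> \<psi>) t))"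
  proof (rule polar_solution)
    show "(\<psi> has_real_derivative ang \<epsilon> (\<psi> t) ((Z \<circ> \<psi>) t) / (Z \<circ> \<psi>) t) (at t)" for t
      using d\<psi>[of t] by (simp add: inv_k)
    show "((Z \<circ> \<psi>) has_real_derivative - 2 * \<epsilon> * (sin (\<psi> t))\<^sup>2 * ((Z \<circ> \<psi>) t - (1 - sg (\<psi> t)))) (at t)" for t
      by (rule DERIV_cong[OF DERIV_chain[OF DERIV_Z d\<psi>]])
         (use ang_Z_pos[of "\<psi> t"] Z_pos[of "\<psi> t"] in \<open>simp add: inv_k\<close>)
  qed (use Z_pos in auto)
  hence sol: "is_solution (planar_field \<epsilon>) UNIV \<gamma>" by (simp add: \<gamma>_def[abs_def] o_def)
  have "\<gamma> (t + T) = \<gamma> t" for t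
    unfolding \<gamma>_def \<psi>_shift using polar_Z_shift[of "\<psi> t" 1] by simp
  moreover have "\<not> \<gamma> constant_on UNIV"
  proof
    assume "\<gamma> constant_on UNIV"
    hence "\<gamma> (\<tau> 0) = \<gamma> (\<tau> pi)" by (auto simp: constant_on_def)
    hence "fst (polar 0 (Z 0)) = fst (polar pi (Z pi))" by (simp add: \<gamma>_def \<psi>\<tau>)
    moreover have "fst (polar 0 (Z 0)) > 0" "fst (polar pi (Z pi)) < 0"
      using Z_pos by (auto simp: polar_def)
    ultimately show False by linarith
  qed
  moreover have "cyc = range \<gamma>"
  proof -
    have "polar p (Z p) \<in> range \<gamma>" for p
      by (rule range_eqI[of _ _ "\<tau> p"]) (simp add: \<gamma>_def \<psi>\<tau>)
    thus ?thesis by (auto simp: cyc_def \<gamma>_def)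
  qed
  ultimately show ?thesis unfolding limit_cycle_def using sol T by blast
qed

section \<open>Relaxation of the ratio to 1\<close>

text \<open>The quotient \<open>z / Z\<close> is the square of the ratio between the radius of the cycle and that of
  the orbit on the same ray.\<close>

lemma ratio_derivative:
  assumes "z t > 0"
    and p: "(p has_real_derivative ang \<epsilon> (p t) (z t) / z t) (at t)"
    and z: "(z has_real_derivative - 2 * \<epsilon> * (sin (p t))\<^sup>2 * (z t - (1 - sg (p t)))) (at t)"
  shows "((\<lambda>t. z t / Z (p t)) has_real_derivative
    2 * \<epsilon> * (sin (p t))\<^sup>2 * (1 - sg (p t)) / ang \<epsilon> (p t) (Z (p t)) * (1 - z t / Z (p t))) (at t)"
proof -
  define q a b v u where "q = 1 - sg (p t)" and "a = ang \<epsilon> (p t) (Z (p t))"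
    and "b = ang \<epsilon> (p t) (z t)" and "v = Z (p t)" and "u = z t"
  have pos: "a > 0" "v > 0" "u > 0" using ang_Z_pos Z_pos assms(1) by (auto simp: a_def v_def u_def)
  \<comment> \<open>The \<epsilon> terms of the two angular speeds cancel here because
    \<open>ang\<close> is affine in \<open>z\<close>.\<close>
  have ab: "(v - q) * b - (u - q) * a = q * (v - u)"
    unfolding a_def b_def ang_def u_def[symmetric] v_def[symmetric] q_def[symmetric]
    by (simp add: algebra_simps)
  have "((\<lambda>t. z t / Z (p t)) has_real_derivative
      ((- 2 * \<epsilon> * (sin (p t))\<^sup>2 * (u - q)) * v
        - u * ((- 2 * \<epsilon> * (sin (p t))\<^sup>2 * v * (v - q) / a) * (b / u))) / (v * v)) (at t)"
    using DERIV_divide[OF z DERIV_chain2[OF DERIV_Z p]] Z_pos[of "p t"]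
    by (simp add: q_def a_def b_def v_def u_def)
  moreover have "((- 2 * \<epsilon> * (sin (p t))\<^sup>2 * (u - q)) * v
        - u * ((- 2 * \<epsilon> * (sin (p t))\<^sup>2 * v * (v - q) / a) * (b / u))) / (v * v)
      = 2 * \<epsilon> * (sin (p t))\<^sup>2 * ((v - q) * b - (u - q) * a) / (a * v)"
    using pos by (simp add: field_simps)
  moreover have "\<dots> = 2 * \<epsilon> * (sin (p t))\<^sup>2 * q / a * (1 - u / v)"
    unfolding ab using pos by (simp add: field_simps)
  ultimately show ?thesis by (simp add: q_def a_def v_def u_def)
qed

text \<open>The ratio is driven towards 1 with a nonnegative coefficient, so below this minimum it
  cannot decrease. A lower bound on \<open>z\<close> bounds the radius, which rules out escape to
  infinity.\<close>

lemma ratio_bounds: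
  assumes "t0 \<le> t"
    and pos: "\<And>s. t0 \<le> s \<Longrightarrow> s \<le> t \<Longrightarrow> z s > 0"
    and p: "\<And>s. t0 \<le> s \<Longrightarrow> s \<le> t \<Longrightarrow> (p has_real_derivative ang \<epsilon> (p s) (z s) / z s) (at s)"
    and z: "\<And>s. t0 \<le> s \<Longrightarrow> s \<le> t \<Longrightarrow>
      (z has_real_derivative - 2 * \<epsilon> * (sin (p s))\<^sup>2 * (z s - (1 - sg (p s)))) (at s)"
  shows "z t / Z (p t) \<ge> min 1 (z t0 / Z (p t0))"
proof -
  define k where "k s = 2 * \<epsilon> * (sin (p s))\<^sup>2 * (1 - sg (p s)) / ang \<epsilon> (p s) (Z (p s))" for s
  have k: "k s \<ge> 0" for s
    unfolding k_def using eps sg_bounds[of "p s"] ang_Z_pos[of "p s"]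
    by (intro divide_nonneg_nonneg mult_nonneg_nonneg) auto
  have "- (z t / Z (p t)) \<le> - min 1 (z t0 / Z (p t0))"
  proof (rule barrier_upper[where u = "\<lambda>s. - (z s / Z (p s))" and u' = "\<lambda>s. - (k s * (1 - z s / Z (p s)))"])
    show "((\<lambda>s. - (z s / Z (p s))) has_real_derivative - (k s * (1 - z s / Z (p s)))) (at s)"
      if "t0 \<le> s" "s \<le> t" for s
      unfolding k_def using ratio_derivative[OF pos[OF that] p[OF that] z[OF that]]
      by (rule DERIV_minus)
    show "- (k s * (1 - z s / Z (p s))) \<le> 0" if "- min 1 (z t0 / Z (p t0)) < - (z s / Z (p s))" for s
      using k[of s] that by auto
  qed (use assms(1) in auto)
  thus ?thesis by simp
qed

text \<open>The relaxation rate of the ratio vanishes only where \<open>sin (p s)\<close> does.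
  There the phase moves with speed 1, so the orbit cannot linger; the proof turns this into an
  exponential bound.\<close>

lemma ratio_tendsto:
  assumes pos: "\<And>s. t0 \<le> s \<Longrightarrow> z s > 0"
    and p: "\<And>s. t0 \<le> s \<Longrightarrow> (p has_real_derivative ang \<epsilon> (p s) (z s) / z s) (at s)"
    and z: "\<And>s. t0 \<le> s \<Longrightarrow>
      (z has_real_derivative - 2 * \<epsilon> * (sin (p s))\<^sup>2 * (z s - (1 - sg (p s)))) (at s)"
  shows "((\<lambda>t. z t / Z (p t)) \<longlongrightarrow> 1) at_top"
proof -
  define W where "W t = z t / Z (p t)" for t
  define k where "k s = 2 * \<epsilon> * (sin (p s))\<^sup>2 * (1 - sg (p s)) / ang \<epsilon> (p s) (Z (p s))" for s
  define c where "c = \<epsilon> / (3/2 + \<epsilon>)"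
  have c: "c > 0" using eps by (simp add: c_def)
  have kc: "k s \<ge> c * (sin (p s))\<^sup>2" for s
  proof -
    have "c * (sin (p s))\<^sup>2 = (\<epsilon> * (sin (p s))\<^sup>2 * 1) / (3/2 + \<epsilon>)" by (simp add: c_def)
    also have "\<dots> \<le> (\<epsilon> * (sin (p s))\<^sup>2 * (2 * (1 - sg (p s)))) / ang \<epsilon> (p s) (Z (p s))"
      using eps sg_bounds[of "p s"] ang_Z_pos[of "p s"] ang_Z_le[of "p s"]
      by (intro frac_le mult_left_mono mult_nonneg_nonneg) auto
    finally show ?thesis by (simp add: k_def algebra_simps)
  qed
  define m where "m = min 1 (W t0) / 2"
  have m: "m > 0" using pos[of t0] Z_pos by (auto simp: m_def W_def)
  have zm: "z t \<ge> m" if "t \<ge> t0" for t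
  proof -
    have "min 1 (W t0) \<le> W t"
      unfolding W_def using that pos p z by (intro ratio_bounds) auto
    hence "min 1 (W t0) * (1/2) \<le> W t * Z (p t)"
      using m Z_ge[of "p t"] by (intro mult_mono) (auto simp: m_def)
    thus ?thesis using Z_pos[of "p t"] by (simp add: W_def m_def)
  qed
  \<comment> \<open>The angular speed equals \<open>1 + \<epsilon> * sg (p t) * A t\<close>; the
    lower bound \<open>m\<close> on \<open>z\<close> makes \<open>A\<close> bounded.\<close>
  define A where "A t = (z t - (1 - sg (p t))) / z t" for t
  define A0 where "A0 = 1 + (3/2) / m"
  have A: "\<bar>A t\<bar> \<le> A0" if "t \<ge> t0" for t
  proof -
    have "A t = 1 - (1 - sg (p t)) / z t" using pos[OF that] by (simp add: A_def field_simps)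
    moreover have "0 \<le> (1 - sg (p t)) / z t" using pos[OF that] sg_bounds[of "p t"] by simp
    moreover have "(1 - sg (p t)) / z t \<le> (3/2) / m"
      using zm[OF that] m sg_bounds[of "p t"] by (intro frac_le) auto
    ultimately show ?thesis unfolding A0_def by linarith
  qed
  \<comment> \<open>The summand 2 comes from the derivative of \<open>sg\<close>, the other from
    splitting the mixed term \<epsilon> \<bar>s\<bar> \<open>A0\<close> by the square inequality
    below.\<close>
  define C where "C = 2 + (\<epsilon> * A0)\<^sup>2 / 2"
  have C: "C > 0" by (simp add: C_def add_pos_nonneg)
  define g where "g t = (1 - 2 * (sin (p t))\<^sup>2) * (ang \<epsilon> (p t) (z t) / z t)" for t
  have dsg: "((\<lambda>t. sg (p t)) has_real_derivative g t) (at t)" if "t \<ge> t0" for t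
    unfolding g_def by (rule DERIV_chain2[OF DERIV_sg p[OF that]])
  have g: "1/2 - g t \<le> C * (sin (p t))\<^sup>2" if "t \<ge> t0" for t
  proof -
    define s where "s = sin (p t)"
    have s: "0 \<le> s\<^sup>2" "s\<^sup>2 \<le> 1" by (auto simp: s_def abs_square_le_1)
    have "ang \<epsilon> (p t) (z t) / z t = 1 + \<epsilon> * sg (p t) * A t"
      using pos[OF that] by (simp add: ang_def A_def field_simps)
    hence "g t = 1 - 2 * s\<^sup>2 + (1 - 2 * s\<^sup>2) * (\<epsilon> * sg (p t) * A t)"
      by (simp add: g_def s_def algebra_simps)
    moreover have "\<bar>(1 - 2 * s\<^sup>2) * (\<epsilon> * sg (p t) * A t)\<bar> \<le> 1 * (\<epsilon> * \<bar>s\<bar> * A0)"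
      unfolding abs_mult using s eps A[OF that] sg_bounds(4)[of "p t"]
      by (intro mult_mono) (auto simp: s_def abs_le_iff)
    moreover have "\<epsilon> * \<bar>s\<bar> * A0 \<le> 1/2 + (\<epsilon> * A0)\<^sup>2 / 2 * s\<^sup>2"
    proof -
      have "0 \<le> (1 - \<epsilon> * A0 * \<bar>s\<bar>)\<^sup>2" by simp
      also have "\<dots> = 1 - 2 * (\<epsilon> * \<bar>s\<bar> * A0) + (\<epsilon> * A0)\<^sup>2 * s\<^sup>2"
        by (simp add: power2_diff power_mult_distrib)
      finally show ?thesis by linarith
    qed
    ultimately show ?thesis unfolding C_def s_def[symmetric] distrib_right by linarith
  qed
  \<comment> \<open>Chosen so that the growth of the exponential factor of \<open>H\<close> is
    absorbed by the decay \<open>2 * k s\<close> of the squared deviation.\<close>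
  define \<mu> where "\<mu> = 2 * c / C"
  have \<mu>: "\<mu> > 0" "\<mu> * C = 2 * c" using c C by (auto simp: \<mu>_def)
  \<comment> \<open>The decay rate of \<open>1 - W\<close> is only bounded below by a multiple of \<open>sin\<^sup>2\<close>. Since the derivative
    of \<open>sg\<close> is near \<open>1\<close> where \<open>sin\<close> is small, the correction by \<open>sg\<close> makes the decay uniform.\<close>
  define H where "H t = (1 - W t)\<^sup>2 * exp (\<mu> * (t / 2 - sg (p t)))" for t
  have "H t \<le> H t0" if "t \<ge> t0" for t
  proof (rule DERIV_nonpos_imp_nonincreasing[OF that])
    fix s assume "t0 \<le> s" "s \<le> t"
    have dW: "(W has_real_derivative k s * (1 - W s)) (at s)"
      unfolding W_def k_def using ratio_derivative[OF pos p z] \<open>t0 \<le> s\<close> by blast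
    have dE: "((\<lambda>s. exp (\<mu> * (s / 2 - sg (p s)))) has_real_derivative
        exp (\<mu> * (s / 2 - sg (p s))) * (\<mu> * (1/2 - g s))) (at s)"
      by (auto intro!: derivative_eq_intros dsg[OF \<open>t0 \<le> s\<close>])
    have "((\<lambda>s. (1 - W s)\<^sup>2) has_real_derivative - 2 * k s * (1 - W s)\<^sup>2) (at s)"
      by (auto intro!: derivative_eq_intros dW simp: power2_eq_square)
    from DERIV_mult[OF this dE] have "(H has_real_derivative
        (1 - W s)\<^sup>2 * exp (\<mu> * (s / 2 - sg (p s))) * (\<mu> * (1/2 - g s) - 2 * k s)) (at s)"
      unfolding H_def[abs_def] by (rule DERIV_cong) (simp add: algebra_simps)
    moreover have "\<mu> * (1/2 - g s) - 2 * k s \<le> 0"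
    proof -
      have "\<mu> * (1/2 - g s) \<le> \<mu> * (C * (sin (p s))\<^sup>2)"
        using g[OF \<open>t0 \<le> s\<close>] \<mu> by (intro mult_left_mono) auto
      also have "\<dots> = 2 * (c * (sin (p s))\<^sup>2)" unfolding mult.assoc[symmetric] \<mu>(2) ..
      finally show ?thesis using kc[of s] by linarith
    qed
    ultimately show "\<exists>y. (H has_real_derivative y) (at s) \<and> y \<le> 0"
      by (intro exI conjI) (assumption, rule mult_nonneg_nonpos, simp_all)
  qed
  \<comment> \<open>As \<open>sg\<close> is at most 1/2, the bound on \<open>H\<close> becomes
    exponential decay at rate \<open>\<mu> / 2\<close>.\<close>
  hence le: "(1 - W t)\<^sup>2 \<le> H t0 * exp (\<mu> / 2 - \<mu> / 2 * t)" if "t \<ge> t0" for t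
  proof -
    have "(1 - W t)\<^sup>2 = H t * exp (- (\<mu> * (t / 2 - sg (p t))))"
      by (simp add: H_def exp_minus)
    also have "\<dots> \<le> H t0 * exp (\<mu> / 2 - \<mu> / 2 * t)"
    proof (rule mult_mono)
      have "\<mu> * sg (p t) \<le> \<mu> * (1/2)" using \<mu> sg_bounds[of "p t"] by (intro mult_left_mono) auto
      thus "exp (- (\<mu> * (t / 2 - sg (p t)))) \<le> exp (\<mu> / 2 - \<mu> / 2 * t)"
        by (simp add: algebra_simps)
    qed (use \<open>\<And>t. t0 \<le> t \<Longrightarrow> H t \<le> H t0\<close> that in \<open>auto simp: H_def\<close>)
    finally show ?thesis .
  qed
  have "((\<lambda>t. H t0 * exp (\<mu> / 2 - \<mu> / 2 * t)) \<longlongrightarrow> H t0 * 0) at_top"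
  proof (intro tendsto_mult tendsto_const filterlim_compose[OF exp_at_bot])
    show "filterlim (\<lambda>t. \<mu> / 2 - \<mu> / 2 * t) at_bot at_top"
      unfolding filterlim_at_bot_dense eventually_at_top_linorder
    proof safe
      fix y
      have "\<mu> / 2 - \<mu> / 2 * t < y" if "t \<ge> 2 - 2 * y / \<mu>" for t
      proof -
        have "\<mu> / 2 * (2 - 2 * y / \<mu>) \<le> \<mu> / 2 * t" using that \<mu> by (intro mult_left_mono) auto
        moreover have "\<mu> / 2 * (2 - 2 * y / \<mu>) = \<mu> - y" using \<mu> by (simp add: field_simps)
        ultimately show ?thesis using \<mu>(1) by linarith
      qed
      thus "\<exists>N. \<forall>t\<ge>N. \<mu> / 2 - \<mu> / 2 * t < y" by blast
    qed
  qed
  hence lim: "((\<lambda>t. H t0 * exp (\<mu> / 2 - \<mu> / 2 * t)) \<longlongrightarrow> 0) at_top" by simp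
  have "((\<lambda>t. (1 - W t)\<^sup>2) \<longlongrightarrow> 0) at_top"
    by (rule tendsto_sandwich[OF _ _ tendsto_const lim])
       (use le in \<open>auto simp: eventually_at_top_linorder intro!: exI[of _ t0]\<close>)
  hence "((\<lambda>t. sqrt ((1 - W t)\<^sup>2)) \<longlongrightarrow> sqrt 0) at_top" by (rule tendsto_real_sqrt)
  hence "((\<lambda>t. 1 - W t) \<longlongrightarrow> 0) at_top" by (simp add: tendsto_rabs_zero_iff)
  from tendsto_diff[OF tendsto_const[of 1] this] show ?thesis by (simp add: W_def)
qed

section \<open>Attraction and uniqueness\<close>

lemma nonconstant_maximal_solution_attracted:
  assumes max: "maximal_solution (planar_field \<epsilon>) I \<gamma>" and nc: "\<not> \<gamma> constant_on I"
  shows "attracted_to I \<gamma> cyc"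
proof -
  have sol: "is_solution (planar_field \<epsilon>) I \<gamma>" using max by (simp add: maximal_solution_def)
  then obtain t0 where t0: "t0 \<in> I" by (auto simp: is_solution_def)
  have lip: "\<exists>L. L-lipschitz_on (cball 0 R) (planar_field \<epsilon>)" for R
    by (rule planar_field_lipschitz[OF eps])
  have f0: "planar_field \<epsilon> 0 = 0" by (simp add: planar_field_def zero_prod_def)
  \<comment> \<open>A solution that meets the equilibrium is constant, so polar coordinates are
    available on all of \<open>I\<close>.\<close>
  have nz: "\<gamma> t \<noteq> 0" if "t \<in> I" for t
  proof
    assume "\<gamma> t = 0"
    hence "\<forall>s\<in>I. \<gamma> s = 0" using solution_zero[OF sol f0 lip that] by blast
    thus False using nc by (auto simp: constant_on_def)
  qed
  obtain p z where pz: "\<And>t. t \<in> I \<Longrightarrow> z t > 0" "\<And>t. t \<in> I \<Longrightarrow> \<gamma> t = polar (p t) (z t)"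
    "\<And>t. t \<in> I \<Longrightarrow> (p has_real_derivative ang \<epsilon> (p t) (z t) / z t) (at t)"
    "\<And>t. t \<in> I \<Longrightarrow>
      (z has_real_derivative - 2 * \<epsilon> * (sin (p t))\<^sup>2 * (z t - (1 - sg (p t)))) (at t)"
    using polar_lift[OF sol t0 nz] by metis
  define m where "m = min 1 (z t0 / Z (p t0)) / 2"
  have m: "m > 0" using pz(1)[OF t0] Z_pos by (auto simp: m_def)
  \<comment> \<open>The ratio bound keeps \<open>z\<close> away from 0, that is, the orbit bounded,
    and a bounded maximal solution exists for all later times.\<close>
  have fwd: "{t0..} \<subseteq> I"
  proof (rule maximal_solution_bounded_forward[OF max lip t0])
    fix t assume t: "t \<in> I" "t0 \<le> t"
    have "{t0..t} \<subseteq> I"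
      using sol t0 t(1) mem_is_interval_1_I[of I t0 t] by (auto simp: is_solution_def)
    hence "min 1 (z t0 / Z (p t0)) \<le> z t / Z (p t)"
      using t pz by (intro ratio_bounds) auto
    hence "min 1 (z t0 / Z (p t0)) * (1/2) \<le> z t / Z (p t) * Z (p t)"
      using m Z_ge[of "p t"] by (intro mult_mono) (auto simp: m_def)
    hence "m \<le> z t" using Z_pos[of "p t"] by (simp add: m_def)
    hence "1 / sqrt (z t) \<le> 1 / sqrt m" using m by (intro frac_le) auto
    thus "norm (\<gamma> t) \<le> 1 / sqrt m" using pz t by (simp add: norm_polar)
  qed
  define W where "W t = z t / Z (p t)" for t
  have lim: "(W \<longlongrightarrow> 1) at_top"
    unfolding W_def[abs_def] using fwd pz by (intro ratio_tendsto[of t0]) auto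
  have "((\<lambda>t. sqrt 2 * \<bar>1 / sqrt (W t) - 1\<bar>) \<longlongrightarrow> sqrt 2 * \<bar>1 / sqrt 1 - 1\<bar>) at_top"
    by (intro tendsto_intros lim) auto
  hence lim0: "((\<lambda>t. sqrt 2 * \<bar>1 / sqrt (W t) - 1\<bar>) \<longlongrightarrow> 0) at_top" by simp
  \<comment> \<open>The comparison point is the point of the cycle on the same ray; its radius is at
    most \<open>sqrt 2\<close> because \<open>Z\<close> is at least 1/2.\<close>
  have le: "infdist (\<gamma> t) cyc \<le> sqrt 2 * \<bar>1 / sqrt (W t) - 1\<bar>" if "t \<ge> t0" for t
  proof -
    have tI: "t \<in> I" using fwd that by auto
    have W: "z t = W t * Z (p t)" using Z_pos[of "p t"] by (simp add: W_def)
    have "infdist (\<gamma> t) cyc \<le> dist (\<gamma> t) (polar (p t) (Z (p t)))"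
      by (rule infdist_le) (auto simp: cyc_def)
    also have "\<dots> = \<bar>1 / sqrt (z t) - 1 / sqrt (Z (p t))\<bar>"
      using pz(2)[OF tI] by (simp add: dist_polar)
    also have "1 / sqrt (z t) - 1 / sqrt (Z (p t)) = (1 / sqrt (Z (p t))) * (1 / sqrt (W t) - 1)"
      unfolding W real_sqrt_mult by (simp add: algebra_simps)
    also have "\<bar>\<dots>\<bar> = (1 / sqrt (Z (p t))) * \<bar>1 / sqrt (W t) - 1\<bar>"
      using Z_pos[of "p t"] by (simp add: abs_mult)
    also have "\<dots> \<le> sqrt 2 * \<bar>1 / sqrt (W t) - 1\<bar>"
    proof (rule mult_right_mono)
      have "1 / sqrt (Z (p t)) \<le> 1 / sqrt (1/2)" using Z_ge[of "p t"] by (intro frac_le) auto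
      thus "1 / sqrt (Z (p t)) \<le> sqrt 2" by (simp add: real_sqrt_divide)
    qed simp
    finally show ?thesis .
  qed
  have "((\<lambda>t. infdist (\<gamma> t) cyc) \<longlongrightarrow> 0) at_top"
    by (rule tendsto_sandwich[OF _ _ tendsto_const lim0])
       (auto simp: eventually_at_top_linorder infdist_nonneg intro!: exI[of _ t0] le)
  thus ?thesis unfolding attracted_to_def using fwd by blast
qed

text \<open>Attraction and periodicity place the orbit inside \<open>cyc\<close>, and a positive
  lower bound on the angular speed makes it run through all of it.\<close>

lemma limit_cycle_unique:
  assumes "limit_cycle (planar_field \<epsilon>) \<Gamma>"
  shows "\<Gamma> = cyc"
proof -
  obtain \<gamma> T where sol: "is_solution (planar_field \<epsilon>) UNIV \<gamma>" and T: "T > 0" "\<And>t. \<gamma> (t + T) = \<gamma> t"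
    and nc: "\<not> \<gamma> constant_on UNIV" and \<Gamma>: "\<Gamma> = range \<gamma>"
    using assms unfolding limit_cycle_def by blast
  have "maximal_solution (planar_field \<epsilon>) UNIV \<gamma>"
    using sol by (auto simp: maximal_solution_def)
  hence att: "((\<lambda>t. infdist (\<gamma> t) cyc) \<longlongrightarrow> 0) at_top"
    using nonconstant_maximal_solution_attracted nc by (auto simp: attracted_to_def)
  \<comment> \<open>Along \<open>t + real n * T\<close> the distance to the cycle is constant in
    \<open>n\<close> and also tends to 0, so it is 0.\<close>
  have in_cyc: "\<gamma> t \<in> cyc" for t
  proof -
    have per: "\<gamma> (t + real n * T) = \<gamma> t" for n
    proof (induction n)
      case (Suc n)
      have "t + real (Suc n) * T = (t + real n * T) + T" by (simp add: algebra_simps)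
      thus ?case using Suc T(2) by metis
    qed simp
    have "filterlim (\<lambda>n. t + real n * T) at_top sequentially"
      by (intro filterlim_tendsto_add_at_top[OF tendsto_const]
            filterlim_at_top_mult_tendsto_pos[OF tendsto_const T(1) filterlim_real_sequentially])
    from filterlim_compose[OF att this] have "(\<lambda>n. infdist (\<gamma> t) cyc) \<longlonglongrightarrow> 0"
      by (simp add: per)
    hence "infdist (\<gamma> t) cyc = 0" by (simp add: LIMSEQ_const_iff)
    thus ?thesis using in_closed_iff_infdist_zero[OF closed_cyc] by (auto simp: cyc_def)
  qed
  have "\<gamma> t \<noteq> 0" for t
    using in_cyc[of t] polar_nonzero[OF Z_pos] by (auto simp: cyc_def)
  then obtain p z where pz: "\<And>t. z t > 0" "\<And>t. \<gamma> t = polar (p t) (z t)"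
    "\<And>t. (p has_real_derivative ang \<epsilon> (p t) (z t) / z t) (at t)"
    using polar_lift[OF sol UNIV_I] by (metis UNIV_I)
  \<comment> \<open>Every ray meets the cycle in one point, so membership determines
    \<open>z\<close> from the phase, whichever multiple of \<open>2 * pi\<close> separates the two
    phases.\<close>
  have zZ: "z t = Z (p t)" for t
  proof -
    obtain q where "polar (p t) (z t) = polar q (Z q)" using in_cyc[of t] pz(2) by (auto simp: cyc_def)
    then obtain n :: int where "z t = Z q" "p t = q + 2 * pi * n"
      using polar_eq_iff[OF pz(1) Z_pos] by blast
    thus ?thesis by (simp add: Z_shift)
  qed
  have "bij p"
  proof (rule derivative_bounded_below_imp_bij[OF _ pz(3)])
    show "\<delta> / (3/2) > 0" using delta by simp
    show "\<delta> / (3/2) \<le> ang \<epsilon> (p t) (z t) / z t" for t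
      unfolding zZ using delta ang_Z Z_le Z_pos
      by (intro frac_le) (auto intro: less_imp_le order_trans)
  qed
  hence "range p = UNIV" by (rule bij_is_surj)
  moreover have "range (\<lambda>t. polar (p t) (Z (p t))) = (\<lambda>q. polar q (Z q)) ` range p"
    by (simp add: image_image)
  ultimately have "range (\<lambda>t. polar (p t) (Z (p t))) = cyc" by (simp add: cyc_def)
  thus ?thesis by (simp add: \<Gamma> pz(2) zZ)
qed

end

theorem mainTheorem3:
  fixes \<epsilon> :: real
  assumes "\<epsilon> > 0"
  shows "\<exists>\<Gamma>. limit_cycle (planar_field \<epsilon>) \<Gamma> \<and>
             (\<forall>\<Gamma>'. limit_cycle (planar_field \<epsilon>) \<Gamma>' \<longrightarrow> \<Gamma>' = \<Gamma>) \<and>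
             (\<forall>I \<gamma>. maximal_solution (planar_field \<epsilon>) I \<gamma> \<and> \<not> \<gamma> constant_on I
                \<longrightarrow> attracted_to I \<gamma> \<Gamma>)"
proof -
  interpret planar_parameter \<epsilon> by unfold_locales (rule assms)
  obtain Z where "radial_profile \<epsilon> Z"
    using periodic_radial_profile planar_parameter_axioms
    unfolding radial_profile_def radial_profile_axioms_def by metis
  then interpret radial_profile \<epsilon> Z .
  show ?thesis
    using limit_cycle_cyc limit_cycle_unique nonconstant_maximal_solution_attracted by blast
qed

end
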